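(* The following upper bounds hold: $R_{(5,5)}\le0.16894$, $R_{(6,5)}\le0.34512$, $R_{(6,6)}\le0.08475$, $R_{(7,6)}\le0.19897$, $R_{(8,6)}\le0.31799$, $R_{(9,6)}\le0.43237$, $R_{(10,6)}\le0.53909$, $R_{(11,6)}\le0.63766$, $R_{(12,6)}\le0.72848$, $R_{(13,6)}\le0.81227$, $R_{(14,6)}\le0.88978$, $R_{(7,7)}\le0.04090$, $R_{(8,7)}\le0.10865$, $R_{(9,7)}\le0.19054$, $R_{(10,7)}\le0.27741$, $R_{(11,7)}\le0.36424$, $R_{(12,7)}\le0.44850$, $R_{(13,7)}\le0.52902$, $R_{(14,7)}\le0.60538$, $R_{(8,8)}\le0.01889$, $R_{(9,8)}\le0.05616$, $R_{(10,8)}\le0.10791$, $R_{(11,8)}\le0.16878$, $R_{(12,8)}\le0.23451$, $R_{(13,8)}\le0.30214$, $R_{(14,8)}\le0.36974$, $R_{(10,9)}\le0.02773$, $R_{(11,9)}\le0.05796$, $R_{(12,9)}\le0.09730$, $R_{(13,9)}\le0.14332$, $R_{(14,9)}\le0.19382$, $R_{(11,10)}\le0.01321$, $R_{(12,10)}\le0.02978$, $R_{(13,10)}\le0.05342$, $R_{(14,10)}\le0.08332$, $R_{(13,11)}\le0.01476$, $R_{(14,11)}\le0.02815$, $R_{(14,12)}\le0.00712$, $R_{(15,13)}\le0.00335$.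
   Context: All logarithms are to base 2. For integers $b\ge k$ and $n\ge1$, a $(b,k)$-hash code of length $n$ is a subset $C\subseteq\{1,\dots,b\}^n$ such that for any $k$ distinct elements of $C$ there is a coordinate in which they are pairwise distinct; $A(b,k,n)$ is the largest size of such a code and $R_{(b,k)}=\limsup_{n\to\infty}\frac1n\log A(b,k,n)$. *)

theory Defs
  imports "HOL-Analysis.Analysis"
begin

definition words :: "nat \<Rightarrow> nat \<Rightarrow> nat list set" where
  "words b n = {w. length w = n \<and> set w \<subseteq> {1..b}}"

definition hash_code :: "nat \<Rightarrow> nat \<Rightarrow> nat \<Rightarrow> nat list set \<Rightarrow> bool" where
  "hash_code b k n C \<longleftrightarrow> C \<subseteq> words b n \<and>
     (\<forall>K \<subseteq> C. card K = k \<longrightarrow> (\<exists>i<n. inj_on (\<lambda>w. w ! i) K))"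

definition A_hash :: "nat \<Rightarrow> nat \<Rightarrow> nat \<Rightarrow> nat" where
  "A_hash b k n = Max {card C | C. hash_code b k n C}"

definition R_hash :: "nat \<Rightarrow> nat \<Rightarrow> ereal" where
  "R_hash b k = limsup (\<lambda>n. ereal (log 2 (real (A_hash b k n)) / real n))"

end

theory Submission
  imports Defs
begin

text \<open>
  Fix \<open>m = k - 2\<close> codewords of a \<open>(b, k)\<close>-hash code \<open>C\<close>. In every coordinate where they are pairwise
  distinct, the remaining codewords avoiding their symbols are coloured by \<open>b - m\<close> colours, and any
  two remaining codewords are separated by one of these partial colourings; Hansel's lemma then bounds
  \<open>log |C|\<close> by the average fraction of coloured codewords, summed over the coordinates.

  The \<open>m\<close> codewords are drawn from the part of \<open>C\<close> in a random cell, obtained by choosing \<open>m - 1\<close>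
  symbols in each of the first \<open>n0\<close> coordinates, so that these coordinates contribute nothing. The
  cells can be so small that \<open>n0\<close> is close to \<open>log |C| / log (b / (m - 1))\<close> while they still contain
  many codewords. In another coordinate, let \<open>p\<close> be the distribution of symbols within the cell
  and \<open>q\<close>, the mean of \<open>p\<close>, the distribution within \<open>C\<close>. The expected contribution is the mean of
  \<open>\<Psi>(p, q)\<close>, the probability that \<open>m\<close> samples of \<open>p\<close> and one sample of \<open>q\<close> are distinct.

  This mean is largest when everything is uniform. Indeed \<open>\<Psi>(p, q) + s (\<langle>p, q\<rangle> - |q|\<^sup>2)\<close> has the same
  mean, and transferring mass between pairs of coordinates shows that it is maximal when \<open>p\<close> is
  uniform on a set of symbols, which leaves one inequality for each size of this set.
\<close>

section \<open>Hansel's lemma for partial colourings\<close>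

text \<open>Induction on the number of coordinates. The members uncoloured in the last coordinate
  together with any single colour class are separated by the other coordinates alone, so their
  weight is at most 1. Averaging over the at most \<open>B\<close> colours of \<open>S n\<close>
  gives the factor \<open>1 / B\<close> on the coloured members.\<close>

lemma Kraft_partial_colouring:
  fixes col :: "nat \<Rightarrow> 'v \<Rightarrow> 'c" and S :: "nat \<Rightarrow> 'c set" and B :: nat
  assumes "finite V" "\<And>i. i < n \<Longrightarrow> finite (S i)" "\<And>i. i < n \<Longrightarrow> card (S i) \<le> B" "B \<ge> 1"
    and "\<And>y z. y \<in> V \<Longrightarrow> z \<in> V \<Longrightarrow> y \<noteq> z \<Longrightarrow>
           \<exists>i<n. col i y \<in> S i \<and> col i z \<in> S i \<and> col i y \<noteq> col i z"
  shows "(\<Sum>y\<in>V. \<Prod>i<n. if col i y \<in> S i then 1 / real B else 1) \<le> 1"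
  using assms
proof (induction n arbitrary: V)
  case 0
  then have "\<And>y z. y \<in> V \<Longrightarrow> z \<in> V \<Longrightarrow> y = z"
    by auto
  then have "card V \<le> 1"
    by (metis card_le_Suc0_iff_eq One_nat_def 0(1))
  then show ?case by simp
next
  case (Suc n)
  define w where "w y = (\<Prod>i<n. if col i y \<in> S i then 1 / real B else 1)" for y
  have w0: "w y \<ge> 0" for y
    unfolding w_def by (intro prod_nonneg) auto
  define U where "U = {y \<in> V. col n y \<notin> S n}"
  define D where "D = {y \<in> V. col n y \<in> S n}"
  have fin: "finite U" "finite D" "U \<inter> D = {}" "V = U \<union> D"
    using Suc.prems(1) by (auto simp: U_def D_def)
  have split: "(\<Sum>y\<in>V. \<Prod>i<Suc n. if col i y \<in> S i then 1 / real B else 1) = sum w U + sum w D / B"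
  proof -
    have "(\<Sum>y\<in>V. \<Prod>i<Suc n. if col i y \<in> S i then 1 / real B else 1)
        = (\<Sum>y\<in>V. w y * (if col n y \<in> S n then 1 / real B else 1))"
      by (simp add: w_def)
    also have "\<dots> = (\<Sum>y\<in>U. w y * (if col n y \<in> S n then 1 / real B else 1))
        + (\<Sum>y\<in>D. w y * (if col n y \<in> S n then 1 / real B else 1))"
      using fin by (simp add: sum.union_disjoint)
    also have "\<dots> = sum w U + (\<Sum>y\<in>D. w y / B)"
      by (intro arg_cong2[where f = "(+)"] sum.cong) (auto simp: U_def D_def)
    finally show ?thesis by (simp add: sum_divide_distrib)
  qed
  \<comment> \<open>If the coloured members of \<open>V'\<close> share one colour in coordinate
    \<open>n\<close>, that coordinate separates no pair of \<open>V'\<close>.\<close>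
  have IH: "sum w V' \<le> 1"
    if sub: "V' \<subseteq> V" and mono: "\<And>y z. y \<in> V' \<Longrightarrow> z \<in> V' \<Longrightarrow> col n y \<in> S n \<Longrightarrow> col n z \<in> S n \<Longrightarrow> col n y = col n z" for V'
    unfolding w_def
  proof (rule Suc.IH)
    show "finite V'" using sub Suc.prems(1) finite_subset by blast
    show "\<exists>i<n. col i y \<in> S i \<and> col i z \<in> S i \<and> col i y \<noteq> col i z" if yz: "y \<in> V'" "z \<in> V'" "y \<noteq> z" for y z
    proof -
      obtain i where "i < Suc n" "col i y \<in> S i" "col i z \<in> S i" "col i y \<noteq> col i z"
        using Suc.prems(5)[of y z] yz sub by blast
      moreover have "i \<noteq> n"
        using calculation mono[OF yz(1,2)] by blast
      ultimately show ?thesis using less_Suc_eq by auto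
    qed
  qed (use Suc.prems in auto)
  show ?case
  proof (cases "S n = {}")
    case True
    then have "D = {}" "U \<subseteq> V" by (auto simp: D_def U_def)
    moreover have "sum w U \<le> 1"
      by (rule IH) (use True in \<open>auto simp: U_def\<close>)
    ultimately show ?thesis using split by simp
  next
    case False
    define s where "s = card (S n)"
    have s: "s \<ge> 1" "s \<le> B" "finite (S n)"
      using False Suc.prems(2-3)[of n] by (auto simp: s_def card_gt_0_iff Suc_le_eq)
    have "sum w U + (\<Sum>y | y \<in> D \<and> col n y = c. w y) \<le> 1" if "c \<in> S n" for c
    proof -
      have "sum w U + (\<Sum>y | y \<in> D \<and> col n y = c. w y) = sum w (U \<union> {y \<in> D. col n y = c})"
        using fin by (subst sum.union_disjoint) auto
      also have "\<dots> \<le> 1"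
        by (rule IH) (auto simp: U_def D_def)
      finally show ?thesis .
    qed
    then have "(\<Sum>c\<in>S n. sum w U + (\<Sum>y | y \<in> D \<and> col n y = c. w y)) \<le> (\<Sum>c\<in>S n. 1)"
      by (intro sum_mono) auto
    also have "(\<Sum>c\<in>S n. sum w U + (\<Sum>y | y \<in> D \<and> col n y = c. w y))
        = s * sum w U + (\<Sum>c\<in>S n. \<Sum>y | y \<in> D \<and> col n y = c. w y)"
      by (simp add: sum.distrib s_def)
    also have "(\<Sum>c\<in>S n. \<Sum>y | y \<in> D \<and> col n y = c. w y) = sum w D"
      by (rule sum.group[OF fin(2) s(3)]) (auto simp: D_def)
    finally have "s * sum w U + sum w D \<le> s" by (simp add: s_def)
    then have "sum w U + sum w D / s \<le> 1"
      using s by (simp add: field_simps)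
    moreover have "sum w D / B \<le> sum w D / s"
      using s by (intro divide_left_mono) (auto intro!: sum_nonneg w0)
    ultimately show ?thesis using split by simp
  qed
qed

text \<open>If \<open>d y\<close> coordinates colour \<open>y\<close>, the Kraft sum reads
  \<open>\<Sum>y. exp (- (ln B * d y)) \<le> 1\<close>. Jensen's inequality for \<open>exp\<close>
  turns this into a lower bound on the average of \<open>d\<close>, and double counting rewrites the
  sum of \<open>d\<close> coordinate by coordinate.\<close>

lemma Hansel_partial_colouring:
  fixes col :: "nat \<Rightarrow> 'v \<Rightarrow> 'c" and S :: "nat \<Rightarrow> 'c set" and B :: nat
  assumes "finite V" "\<And>i. i < n \<Longrightarrow> finite (S i)" "\<And>i. i < n \<Longrightarrow> card (S i) \<le> B" "B \<ge> 1"
    and "\<And>y z. y \<in> V \<Longrightarrow> z \<in> V \<Longrightarrow> y \<noteq> z \<Longrightarrow>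
           \<exists>i<n. col i y \<in> S i \<and> col i z \<in> S i \<and> col i y \<noteq> col i z"
  shows "card V * ln (card V) \<le> ln B * (\<Sum>i<n. card {y \<in> V. col i y \<in> S i})"
proof (cases "V = {}")
  case False
  define d where "d y = card {i. i < n \<and> col i y \<in> S i}" for y
  define N where "N = card V"
  have N: "N > 0" using False assms(1) by (simp add: N_def card_gt_0_iff)
  have w: "(\<Prod>i<n. if col i y \<in> S i then 1 / real B else 1) = exp (- (ln B * d y))" for y
  proof -
    have "(\<Prod>i<n. if col i y \<in> S i then 1 / real B else 1) = (1 / real B) ^ d y"
      unfolding d_def
      by (subst prod.If_cases) (simp_all add: Int_def lessThan_def)
    also have "\<dots> = exp (- (ln B)) ^ d y"
      using assms(4) by (simp add: exp_minus inverse_eq_divide)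
    finally show ?thesis by (simp add: exp_of_nat_mult[symmetric] mult.commute)
  qed
  have dsum: "(\<Sum>y\<in>V. real (d y)) = (\<Sum>i<n. card {y \<in> V. col i y \<in> S i})"
  proof -
    have "(\<Sum>y\<in>V. d y) = (\<Sum>y\<in>V. \<Sum>i<n. if col i y \<in> S i then 1 else 0)"
      by (simp add: d_def sum.If_cases Int_def lessThan_def)
    also have "\<dots> = (\<Sum>i<n. \<Sum>y\<in>V. if col i y \<in> S i then 1 else 0)"
      by (rule sum.swap)
    also have "\<dots> = (\<Sum>i<n. card {y \<in> V. col i y \<in> S i})"
      using assms(1) by (simp add: sum.If_cases Int_def)
    finally show ?thesis by (metis of_nat_sum)
  qed
  have "exp (\<Sum>y\<in>V. (1 / N) *\<^sub>R (- (ln B * d y))) \<le> (\<Sum>y\<in>V. (1 / N) * exp (- (ln B * d y)))"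
    using N False assms(1) by (intro convex_on_sum[OF _ _ exp_convex]) (auto simp: N_def)
  also have "\<dots> = (1 / N) * (\<Sum>y\<in>V. exp (- (ln B * d y)))"
    by (simp add: sum_distrib_left)
  also have "\<dots> \<le> (1 / N) * 1"
    using Kraft_partial_colouring[OF assms] unfolding w by (intro mult_left_mono) auto
  also have "\<dots> = exp (- ln N)"
    using N by (simp add: exp_minus inverse_eq_divide)
  finally have "(\<Sum>y\<in>V. (1 / N) *\<^sub>R (- (ln B * d y))) \<le> - ln N"
    by simp
  also have "(\<Sum>y\<in>V. (1 / N) *\<^sub>R (- (ln B * d y))) = - (ln B * (\<Sum>y\<in>V. real (d y)) / N)"
    by (simp add: sum_negf sum_distrib_left sum_divide_distrib)
  finally show ?thesis
    using N unfolding dsum by (simp add: N_def field_simps)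
qed simp

section \<open>Elementary symmetric polynomials and their directional derivatives\<close>

definition esym :: "'a set \<Rightarrow> nat \<Rightarrow> ('a \<Rightarrow> real) \<Rightarrow> real" where
  "esym A m p = (\<Sum>T | T \<subseteq> A \<and> card T = m. prod p T)"

text \<open>The derivative of the elementary symmetric polynomial of degree \<open>m + 1\<close> at
  \<open>p\<close> in direction \<open>q\<close>. For probability vectors, \<open>fact m\<close>
  times it is the probability \<Psi>(p, q) that \<open>m\<close> samples of \<open>p\<close> and one
  of \<open>q\<close> are distinct.\<close>

definition esym_deriv :: "'a set \<Rightarrow> nat \<Rightarrow> ('a \<Rightarrow> real) \<Rightarrow> ('a \<Rightarrow> real) \<Rightarrow> real" where
  "esym_deriv A m p q = (\<Sum>T | T \<subseteq> A \<and> card T = m. prod p T * sum q (A - T))"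

lemma sum_subsets_card_insert:
  assumes "finite A" "a \<notin> A"
  shows "(\<Sum>T | T \<subseteq> insert a A \<and> card T = Suc m. f T)
       = (\<Sum>T | T \<subseteq> A \<and> card T = Suc m. f T) + (\<Sum>T | T \<subseteq> A \<and> card T = m. f (insert a T))"
proof -
  have eq: "{T. T \<subseteq> insert a A \<and> card T = Suc m}
      = {T. T \<subseteq> A \<and> card T = Suc m} \<union> insert a ` {T. T \<subseteq> A \<and> card T = m}" (is "?L = ?R1 \<union> insert a ` ?R2")
  proof (intro equalityI subsetI)
    fix T assume T: "T \<in> ?L"
    show "T \<in> ?R1 \<union> insert a ` ?R2"
    proof (cases "a \<in> T")
      case True
      have "finite T" using T assms(1) by (auto intro: finite_subset)
      then have "T - {a} \<in> ?R2" "T = insert a (T - {a})"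
        using T True by auto
      then show ?thesis by blast
    qed (use T in auto)
  next
    fix T assume "T \<in> ?R1 \<union> insert a ` ?R2"
    then show "T \<in> ?L"
    proof
      assume "T \<in> insert a ` ?R2"
      then obtain T' where T': "T = insert a T'" "T' \<subseteq> A" "card T' = m" by auto
      moreover have "finite T'" "a \<notin> T'" using T' assms finite_subset by auto
      ultimately show ?thesis by auto
    qed auto
  qed
  have inj: "inj_on (insert a) ?R2"
    using assms(2) by (intro inj_onI) (metis (no_types, lifting) insert_ident mem_Collect_eq subsetD)
  have "sum f ?L = sum f ?R1 + sum f (insert a ` ?R2)"
    unfolding eq by (rule sum.union_disjoint) (use assms in auto)
  then show ?thesis
    by (simp add: sum.reindex[OF inj])
qed

lemma esym_insert:
  assumes "finite A" "a \<notin> A"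
  shows "esym (insert a A) (Suc m) p = esym A (Suc m) p + p a * esym A m p"
proof -
  have "(\<Sum>T | T \<subseteq> A \<and> card T = m. prod p (insert a T)) = (\<Sum>T | T \<subseteq> A \<and> card T = m. p a * prod p T)"
    using assms by (intro sum.cong refl prod.insert) (auto intro: finite_subset)
  then show ?thesis
    by (simp add: esym_def sum_subsets_card_insert[OF assms] sum_distrib_left)
qed

lemma esym_deriv_insert:
  assumes "finite A" "a \<notin> A"
  shows "esym_deriv (insert a A) (Suc m) p q
       = esym_deriv A (Suc m) p q + q a * esym A (Suc m) p + p a * esym_deriv A m p q"
proof -
  have "(\<Sum>T | T \<subseteq> A \<and> card T = m. prod p (insert a T) * sum q (insert a A - insert a T))
      = (\<Sum>T | T \<subseteq> A \<and> card T = m. p a * (prod p T * sum q (A - T)))"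
  proof (intro sum.cong refl)
    fix T assume "T \<in> {T. T \<subseteq> A \<and> card T = m}"
    then have "finite T" "a \<notin> T" "insert a A - insert a T = A - T"
      using assms by (auto intro: finite_subset)
    then show "prod p (insert a T) * sum q (insert a A - insert a T) = p a * (prod p T * sum q (A - T))"
      by simp
  qed
  moreover have "(\<Sum>T | T \<subseteq> A \<and> card T = Suc m. prod p T * sum q (insert a A - T))
      = (\<Sum>T | T \<subseteq> A \<and> card T = Suc m. prod p T * sum q (A - T) + q a * prod p T)"
  proof (intro sum.cong refl)
    fix T assume "T \<in> {T. T \<subseteq> A \<and> card T = Suc m}"
    then have "insert a A - T = insert a (A - T)" "a \<notin> A - T" "finite (A - T)"
      using assms by auto
    then show "prod p T * sum q (insert a A - T) = prod p T * sum q (A - T) + q a * prod p T"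
      by (simp add: algebra_simps)
  qed
  ultimately show ?thesis
    by (simp add: esym_def esym_deriv_def sum_subsets_card_insert[OF assms] sum_distrib_left sum.distrib)
qed

lemma esym_cong: "(\<And>a. a \<in> A \<Longrightarrow> p a = p' a) \<Longrightarrow> esym A m p = esym A m p'"
  unfolding esym_def by (rule sum.cong[OF refl], rule prod.cong) auto

lemma esym_deriv_cong:
  "(\<And>a. a \<in> A \<Longrightarrow> p a = p' a) \<Longrightarrow> (\<And>a. a \<in> A \<Longrightarrow> q a = q' a) \<Longrightarrow>
     esym_deriv A m p q = esym_deriv A m p' q'"
proof -
  assume eq: "\<And>a. a \<in> A \<Longrightarrow> p a = p' a" "\<And>a. a \<in> A \<Longrightarrow> q a = q' a"
  have "prod p T * sum q (A - T) = prod p' T * sum q' (A - T)" if "T \<subseteq> A" for T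
  proof -
    have "prod p T = prod p' T" using eq(1) that by (intro prod.cong) auto
    moreover have "sum q (A - T) = sum q' (A - T)" using eq(2) by (intro sum.cong) auto
    ultimately show ?thesis by simp
  qed
  then show ?thesis unfolding esym_deriv_def by (intro sum.cong) auto
qed

section \<open>Reduction to distributions that are uniform on their support\<close>

text \<open>
  The penalty is affine in \<open>p\<close> and vanishes on average over any family of vectors \<open>p\<close> with mean
  \<open>q\<close>, so it may be added freely when bounding such an average. It makes the functional concave
  in \<open>q\<close>, which is why \<open>q\<close> need not be restricted to nonnegative vectors below.
\<close>
definition penalised :: "'a set \<Rightarrow> nat \<Rightarrow> real \<Rightarrow> ('a \<Rightarrow> real) \<Rightarrow> ('a \<Rightarrow> real) \<Rightarrow> real" where
  "penalised U m s p q = esym_deriv U m p q + s * (\<Sum>a\<in>U. q a * p a - (q a)\<^sup>2)"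

lemma penalised_cong:
  "(\<And>a. a \<in> U \<Longrightarrow> p a = p' a) \<Longrightarrow> penalised U m s p q = penalised U m s p' q"
  using esym_deriv_cong[of U p p' q q m] by (simp add: penalised_def)

text \<open>Both \<open>esym\<close> and \<open>esym_deriv\<close> are affine in each single entry
  and symmetric under exchanging \<open>i\<close> and \<open>l\<close>, so the two entries share
  their coefficients. These are values on \<open>U - {i, l}\<close>, found by splitting off
  \<open>i\<close> and \<open>l\<close> in turn; \<open>m \<ge> 2\<close> lets the degree drop
  twice.\<close>

lemma penalised_pair_expansion:
  assumes "finite U" "i \<in> U" "l \<in> U" "i \<noteq> l" "m \<ge> 2"
  obtains \<alpha> \<beta> \<gamma> B C where
    "\<And>x x' y y'. penalised U m s (p(i := x, l := x')) (q(i := y, l := y'))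
       = \<alpha> + (y + y') * \<beta> + (x + x') * \<gamma> + (x * y' + x' * y) * C + x * x' * B
         + s * (x * y + x' * y' - y\<^sup>2 - y'\<^sup>2)"
proof -
  define W where "W = U - {i, l}"
  have W: "finite W" "l \<notin> W" "i \<notin> insert l W" "U = insert i (insert l W)" "finite (insert l W)"
    using assms by (auto simp: W_def)
  obtain r where m: "m = Suc (Suc r)"
    using assms(5) by (metis Suc_le_D numeral_2_eq_2 Suc_le_mono)
  have "penalised U m s (p(i := x, l := x')) (q(i := y, l := y'))
     = (esym_deriv W (Suc (Suc r)) p q + s * (\<Sum>a\<in>W. q a * p a - (q a)\<^sup>2))
       + (y + y') * esym W (Suc (Suc r)) p + (x + x') * esym_deriv W (Suc r) p q
       + (x * y' + x' * y) * esym W (Suc r) p + x * x' * esym_deriv W r p q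
       + s * (x * y + x' * y' - y\<^sup>2 - y'\<^sup>2)" for x x' y y'
  proof -
    let ?p = "p(i := x, l := x')" and ?q = "q(i := y, l := y')"
    have "esym W j ?p = esym W j p" "esym_deriv W j ?p ?q = esym_deriv W j p q" for j
      using W by (auto intro!: esym_cong esym_deriv_cong)
    moreover have "(\<Sum>a\<in>W. ?q a * ?p a - (?q a)\<^sup>2) = (\<Sum>a\<in>W. q a * p a - (q a)\<^sup>2)"
      using W by (intro sum.cong) auto
    moreover have "?p i = x" "?p l = x'" "?q i = y" "?q l = y'"
      using assms(4) by auto
    ultimately show ?thesis
      unfolding penalised_def W(4) m esym_deriv_insert[OF W(5,3)] esym_deriv_insert[OF W(1,2)]
        esym_insert[OF W(1,2)] sum.insert[OF W(5,3)] sum.insert[OF W(1,2)]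
      by (simp only:) (simp add: algebra_simps)
  qed
  then show thesis by (rule that)
qed

text \<open>Keep the pair sums of \<open>p\<close> and \<open>q\<close> fixed and write the entries
  as mean plus or minus \<open>u\<close> for \<open>p\<close> and mean plus or minus
  \<open>v\<close> for \<open>q\<close>. The functional is then even in \<open>(u, v)\<close> and,
  because \<open>s > 0\<close>, concave in \<open>v\<close>; completing the square in
  \<open>v\<close> leaves a quadratic in \<open>u\<close> alone.\<close>

lemma penalised_pair_quadratic:
  fixes p q :: "'a \<Rightarrow> real"
  assumes "finite U" "i \<in> U" "l \<in> U" "i \<noteq> l" "m \<ge> 2" "s > 0"
  obtains \<kappa> \<mu> where
    "penalised U m s p q \<le> \<kappa> + \<mu> * ((p i - p l) / 2)\<^sup>2"
    "\<And>u. \<exists>q'. sum q' U = sum q U \<and>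
        penalised U m s (p(i := (p i + p l) / 2 + u, l := (p i + p l) / 2 - u)) q' = \<kappa> + \<mu> * u\<^sup>2"
proof -
  obtain \<alpha> \<beta> \<gamma> B C where ex:
    "\<And>x x' y y'. penalised U m s (p(i := x, l := x')) (q(i := y, l := y'))
       = \<alpha> + (y + y') * \<beta> + (x + x') * \<gamma> + (x * y' + x' * y) * C + x * x' * B
         + s * (x * y + x' * y' - y\<^sup>2 - y'\<^sup>2)"
    by (rule penalised_pair_expansion[OF assms(1-5), where s = s and p = p and q = q]) (rule that)
  define h where "h = (p i + p l) / 2"
  define t where "t = (q i + q l) / 2"
  define \<kappa> where "\<kappa> = \<alpha> + 2 * t * \<beta> + 2 * h * \<gamma> + 2 * h * t * C + h\<^sup>2 * B + s * (2 * h * t - 2 * t\<^sup>2)"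
  define \<mu> where "\<mu> = (s - C)\<^sup>2 / (2 * s) - B"
  \<comment> \<open>The optimal \<open>v\<close> is \<open>(s - C) * u / (2 * s)\<close>, where the
    subtracted square vanishes.\<close>
  have val: "penalised U m s (p(i := h + u, l := h - u)) (q(i := t + v, l := t - v))
      = \<kappa> + \<mu> * u\<^sup>2 - 2 * s * (v - (s - C) * u / (2 * s))\<^sup>2" for u v
    unfolding ex \<kappa>_def \<mu>_def using assms(6) by (simp add: field_simps power2_eq_square)
  have sumq: "sum (q(i := t + v, l := t - v)) U = sum q U" for v
  proof -
    have "sum f U = f i + (f l + sum f (U - {i} - {l}))" for f :: "'a \<Rightarrow> real"
      using assms by (simp add: sum.remove[of U i] sum.remove[of "U - {i}" l])
    moreover have "sum (q(i := t + v, l := t - v)) (U - {i} - {l}) = sum q (U - {i} - {l})"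
      by (intro sum.cong) auto
    ultimately show ?thesis
      using assms(4) by (simp add: t_def)
  qed
  show thesis
  proof (rule that)
    let ?u = "(p i - p l) / 2" and ?v = "(q i - q l) / 2"
    have "p(i := h + ?u, l := h - ?u) = p" "q(i := t + ?v, l := t - ?v) = q"
      by (auto simp: h_def t_def fun_eq_iff field_simps)
    then have "penalised U m s p q = \<kappa> + \<mu> * ?u\<^sup>2 - 2 * s * (?v - (s - C) * ?u / (2 * s))\<^sup>2"
      using val[of ?u ?v] by simp
    also have "\<dots> \<le> \<kappa> + \<mu> * ?u\<^sup>2"
      using assms(6) by simp
    finally show "penalised U m s p q \<le> \<kappa> + \<mu> * ?u\<^sup>2" .
  next
    fix u
    show "\<exists>q'. sum q' U = sum q U \<and>
        penalised U m s (p(i := (p i + p l) / 2 + u, l := (p i + p l) / 2 - u)) q' = \<kappa> + \<mu> * u\<^sup>2"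
      using val[of u "(s - C) * u / (2 * s)"] sumq
      by (intro exI[of _ "q(i := t + (s - C) * u / (2 * s), l := t - (s - C) * u / (2 * s))"])
        (simp add: h_def)
  qed
qed

lemma exists_below_and_above_average:
  fixes p :: "'a \<Rightarrow> real"
  assumes "finite T" "sum p T = 1" "\<not> (\<forall>a\<in>T. p a = 1 / card T)"
  obtains i l where "i \<in> T" "l \<in> T" "p i < 1 / card T" "1 / card T < p l"
proof -
  have T: "T \<noteq> {}" using assms(2) by auto
  then have avg: "(\<Sum>a\<in>T. 1 / real (card T)) = sum p T"
    using assms by simp
  have "\<exists>i\<in>T. p i < 1 / card T"
  proof (rule ccontr)
    assume "\<not> ?thesis"
    then have ge: "\<And>a. a \<in> T \<Longrightarrow> 1 / card T \<le> p a" by force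
    then have "\<exists>a\<in>T. 1 / card T < p a" using assms(3) by force
    then have "(\<Sum>a\<in>T. 1 / real (card T)) < sum p T"
      using assms(1) ge by (intro sum_strict_mono_ex1) auto
    then show False using avg by simp
  qed
  moreover have "\<exists>l\<in>T. 1 / card T < p l"
  proof (rule ccontr)
    assume "\<not> ?thesis"
    then have ge: "\<And>a. a \<in> T \<Longrightarrow> p a \<le> 1 / card T" by force
    then have "\<exists>a\<in>T. p a < 1 / card T" using assms(3) by force
    then have "sum p T < (\<Sum>a\<in>T. 1 / real (card T))"
      using assms(1) ge by (intro sum_strict_mono_ex1) auto
    then show False using avg by simp
  qed
  ultimately show thesis using that by blast
qed

text \<open>
  Along a transfer of mass between two coordinates, optimised over the corresponding transfer in
  \<open>q\<close>, the functional is \<open>\<kappa> + \<mu> u\<^sup>2\<close> in the difference \<open>u\<close>. According to the sign of \<open>\<mu>\<close>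
  one either empties one of the coordinates or makes one of them equal to the average over the
  support, so that finitely many transfers lead to a uniform distribution.
\<close>
lemma penalised_le_uniform:
  fixes p q :: "'a \<Rightarrow> real"
  assumes "finite U" "m \<ge> 2" "s > 0"
    and "\<And>a. a \<in> U \<Longrightarrow> p a \<ge> 0" "sum p U = 1" "sum q U = 1"
  shows "\<exists>T q'. T \<subseteq> U \<and> T \<noteq> {} \<and> sum q' U = 1 \<and>
    penalised U m s p q \<le> penalised U m s (\<lambda>a. if a \<in> T then 1 / card T else 0) q'"
  using assms(4-6)
\<comment> \<open>The measure is lexicographic: first the support size, then the number of support
  entries that differ from the average. The latter is at most \<open>card U\<close>, hence the
  factor \<open>Suc (card U)\<close>.\<close>
proof (induction "let T = {a \<in> U. p a \<noteq> 0} in card T * Suc (card U) + card {a \<in> T. p a \<noteq> 1 / card T}"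
    arbitrary: p q rule: less_induct)
  case less
  define T where "T = {a \<in> U. p a \<noteq> 0}"
  define E where "E = {a \<in> T. p a \<noteq> 1 / card T}"
  have T: "T \<subseteq> U" "finite T" using assms(1) by (auto simp: T_def)
  have sumT: "sum p T = 1"
    using less.prems(2) assms(1) by (subst sum.mono_neutral_left[of U T]) (auto simp: T_def)
  have IH: "?case" if
    "(let T = {a \<in> U. p' a \<noteq> 0} in card T * Suc (card U) + card {a \<in> T. p' a \<noteq> 1 / card T})
        < card T * Suc (card U) + card E"
    "\<And>a. a \<in> U \<Longrightarrow> p' a \<ge> 0" "sum p' U = 1" "sum q' U = 1"
    "penalised U m s p q \<le> penalised U m s p' q'" for p' q'
    using less.hyps[of p' q'] that order_trans[OF that(5)]
    unfolding Let_def T_def E_def by blast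
  show ?case
  proof (cases "\<forall>a\<in>T. p a = 1 / card T")
    case True
    have "penalised U m s p q = penalised U m s (\<lambda>a. if a \<in> T then 1 / card T else 0) q"
      by (rule penalised_cong) (use True in \<open>auto simp: T_def\<close>)
    moreover have "T \<noteq> {}" using sumT by auto
    ultimately show ?thesis using T less.prems(3) by (intro exI[of _ T] exI[of _ q]) auto
  next
    case False
    then obtain i l where il: "i \<in> T" "l \<in> T" "p i < 1 / card T" "1 / card T < p l"
      using exists_below_and_above_average[OF T(2) sumT] by blast
    then have U: "i \<in> U" "l \<in> U" "i \<noteq> l" using T by auto
    have pos: "p i > 0" "p l > 0"
      using il less.prems(1)[of i] less.prems(1)[of l] by (auto simp: T_def)
    define h where "h = (p i + p l) / 2"
    obtain \<kappa> \<mu> where \<kappa>: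
      "penalised U m s p q \<le> \<kappa> + \<mu> * ((p i - p l) / 2)\<^sup>2"
      "\<And>u. \<exists>q'. sum q' U = sum q U \<and>
        penalised U m s (p(i := h + u, l := h - u)) q' = \<kappa> + \<mu> * u\<^sup>2"
      unfolding h_def using penalised_pair_quadratic[OF assms(1) U assms(2,3), of p q] by blast
    have sump: "sum (p(i := h + u, l := h - u)) U = 1" for u
    proof -
      have "sum f U = f i + (f l + sum f (U - {i} - {l}))" for f :: "'a \<Rightarrow> real"
        using assms(1) U by (simp add: sum.remove[of U i] sum.remove[of "U - {i}" l])
      moreover have "sum (p(i := h + u, l := h - u)) (U - {i} - {l}) = sum p (U - {i} - {l})"
        by (intro sum.cong) auto
      ultimately show ?thesis
        using U less.prems(2) by (simp add: h_def)
    qed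
    show ?thesis
    proof (cases "\<mu> \<ge> 0")
      case True
      \<comment> \<open>With \<mu> nonnegative the largest admissible difference is best: entry
        \<open>i\<close> becomes 0 and \<open>l\<close> takes the whole mass \<open>2 * h\<close>,
        so the support shrinks.\<close>
      define p' where "p' = p(i := h + (-h), l := h - (-h))"
      obtain q' where q': "sum q' U = 1" "penalised U m s p' q' = \<kappa> + \<mu> * (-h)\<^sup>2"
        using \<kappa>(2)[of "-h"] less.prems(3) unfolding p'_def by auto
      have "\<bar>(p i - p l) / 2\<bar> \<le> \<bar>-h\<bar>" using pos by (simp add: h_def)
      then have "((p i - p l) / 2)\<^sup>2 \<le> (-h)\<^sup>2" by (simp only: abs_le_square_iff)
      then have le: "penalised U m s p q \<le> penalised U m s p' q'"
        using \<kappa>(1) q'(2) True by (smt (verit) mult_left_mono)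
      have supp: "{a \<in> U. p' a \<noteq> 0} = T - {i}"
        using U pos by (auto simp: p'_def T_def h_def)
      have "card {a \<in> T - {i}. p' a \<noteq> 1 / card (T - {i})} \<le> card U"
        using T assms(1) by (intro card_mono) auto
      moreover have "card T = Suc (card (T - {i}))"
        using il(1) T(2) by (metis card_Suc_Diff1)
      ultimately show ?thesis
        using sump[of "-h"] q' le less.prems(1) pos supp
        by (intro IH[of p' q']) (auto simp: p'_def Let_def h_def)
    next
      case False
      \<comment> \<open>This \<open>u\<close> sets entry \<open>i\<close> to the average. Since the
        average lies between \<open>p i\<close> and \<open>p l\<close>, the difference does not
        grow, and both entries stay positive; the support is kept while one more entry equals the
        average.\<close>
      define u where "u = 1 / card T - h"
      define p' where "p' = p(i := h + u, l := h - u)"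
      obtain q' where q': "sum q' U = 1" "penalised U m s p' q' = \<kappa> + \<mu> * u\<^sup>2"
        using \<kappa>(2)[of u] less.prems(3) unfolding p'_def by auto
      have "\<bar>u\<bar> \<le> \<bar>(p i - p l) / 2\<bar>" using il by (auto simp: u_def h_def abs_if field_simps)
      then have "u\<^sup>2 \<le> ((p i - p l) / 2)\<^sup>2" by (simp only: abs_le_square_iff)
      then have le: "penalised U m s p q \<le> penalised U m s p' q'"
        using \<kappa>(1) q'(2) False by (smt (verit) mult_left_mono_neg)
      have cT: "1 / card T > 0" using T(2) il(1) by (auto simp: card_gt_0_iff)
      have hu: "h - u > 0" using il pos by (simp add: u_def h_def)
      have supp: "{a \<in> U. p' a \<noteq> 0} = T"
        using U pos il cT hu by (auto simp: p'_def T_def u_def)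
      have "p' i = 1 / card T" using U(3) by (simp add: p'_def u_def)
      then have "{a \<in> T. p' a \<noteq> 1 / card T} \<subseteq> E - {i}"
      proof (intro subsetI)
        fix a assume a: "a \<in> {a \<in> T. p' a \<noteq> 1 / card T}"
        then have "a \<noteq> i" using \<open>p' i = 1 / card T\<close> by blast
        moreover have "p a \<noteq> 1 / card T"
          using a calculation il(4) by (cases "a = l") (simp_all add: p'_def)
        ultimately show "a \<in> E - {i}" using a by (simp add: E_def)
      qed
      moreover have "i \<in> E" using il(1,3) by (simp add: E_def)
      ultimately have "{a \<in> T. p' a \<noteq> 1 / card T} \<subset> E" by blast
      then have "card {a \<in> T. p' a \<noteq> 1 / card T} < card E"
        using T(2) by (intro psubset_card_mono) (auto simp: E_def)
      moreover have "p' a \<ge> 0" if "a \<in> U" for a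
        using that less.prems(1) cT hu by (auto simp: p'_def u_def)
      ultimately show ?thesis
        using sump[of u] q'(1) le supp
        by (intro IH[of p' q']) (simp_all add: p'_def[symmetric] Let_def)
    qed
  qed
qed

section \<open>Values at uniform distributions and the bound on the mean\<close>

lemma sum_subsets_card_sum:
  fixes q :: "'a \<Rightarrow> real"
  assumes "finite T" "m \<ge> 1"
  shows "(\<Sum>S | S \<subseteq> T \<and> card S = m. sum q S) = real ((card T - 1) choose (m - 1)) * sum q T"
proof -
  have "(\<Sum>S | S \<subseteq> T \<and> card S = m. sum q S) = (\<Sum>S | S \<subseteq> T \<and> card S = m. \<Sum>a\<in>T. if a \<in> S then q a else 0)"
    using assms(1) by (intro sum.cong[OF refl]) (auto simp: sum.inter_restrict[symmetric] Int_absorb1)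
  also have "\<dots> = (\<Sum>a\<in>T. \<Sum>S | S \<subseteq> T \<and> card S = m. if a \<in> S then q a else 0)"
    by (rule sum.swap)
  also have "\<dots> = (\<Sum>a\<in>T. real ((card T - 1) choose (m - 1)) * q a)"
  proof (intro sum.cong refl)
    fix a assume a: "a \<in> T"
    define T' where "T' = T - {a}"
    obtain r where r: "m = Suc r" using assms(2) by (cases m) auto
    have T': "finite T'" "a \<notin> T'" "T = insert a T'" "card T' = card T - 1"
      using a assms(1) by (auto simp: T'_def)
    have "(\<Sum>S | S \<subseteq> T \<and> card S = m. if a \<in> S then q a else 0)
        = (\<Sum>S | S \<subseteq> T' \<and> card S = Suc r. if a \<in> S then q a else 0) + (\<Sum>S | S \<subseteq> T' \<and> card S = r. q a)"
      unfolding T'(3) r sum_subsets_card_insert[OF T'(1,2)] by simp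
    also have "(\<Sum>S | S \<subseteq> T' \<and> card S = Suc r. if a \<in> S then q a else 0) = 0"
      using T'(2) by (intro sum.neutral) auto
    finally show "(\<Sum>S | S \<subseteq> T \<and> card S = m. if a \<in> S then q a else 0) = real ((card T - 1) choose (m - 1)) * q a"
      using T'(4) by (simp add: n_subsets[OF T'(1)] r)
  qed
  finally show ?thesis by (simp add: sum_distrib_left)
qed

text \<open>Only the \<open>m\<close>-subsets \<open>S\<close> of \<open>T\<close> contribute, each
  with product \<open>1 / card T ^ m\<close> and outside mass \<open>1 - sum q S\<close>; double
  counting sums these masses.\<close>

lemma esym_deriv_uniform:
  assumes "finite U" "T \<subseteq> U" "m \<ge> 1" "sum q U = 1"
  shows "esym_deriv U m (\<lambda>a. if a \<in> T then 1 / card T else 0) q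
      = (real (card T choose m) - real ((card T - 1) choose (m - 1)) * sum q T) / real (card T) ^ m"
proof -
  have T: "finite T" using assms finite_subset by blast
  let ?p = "\<lambda>a. if a \<in> T then 1 / real (card T) else 0"
  have "esym_deriv U m ?p q = (\<Sum>S | S \<subseteq> T \<and> card S = m. prod ?p S * sum q (U - S))"
    unfolding esym_deriv_def
  proof (rule sum.mono_neutral_right)
    show "\<forall>S\<in>{S. S \<subseteq> U \<and> card S = m} - {S. S \<subseteq> T \<and> card S = m}. prod ?p S * sum q (U - S) = 0"
    proof
      fix S assume S: "S \<in> {S. S \<subseteq> U \<and> card S = m} - {S. S \<subseteq> T \<and> card S = m}"
      then have "finite S" "\<exists>a\<in>S. ?p a = 0" using assms(1) finite_subset by auto
      then show "prod ?p S * sum q (U - S) = 0" by (simp only: prod_zero mult_zero_left)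
    qed
  qed (use assms in auto)
  also have "\<dots> = (\<Sum>S | S \<subseteq> T \<and> card S = m. (1 - sum q S) / real (card T) ^ m)"
  proof (intro sum.cong refl)
    fix S assume "S \<in> {S. S \<subseteq> T \<and> card S = m}"
    then have S: "S \<subseteq> T" "card S = m" by auto
    have "prod ?p S = (\<Prod>a\<in>S. 1 / real (card T))" using S by (intro prod.cong) auto
    then have "prod ?p S = 1 / real (card T) ^ m" using S by (simp add: power_one_over)
    moreover have "sum q (U - S) = 1 - sum q S"
      using S assms T by (subst sum_diff) auto
    ultimately show "prod ?p S * sum q (U - S) = (1 - sum q S) / real (card T) ^ m" by simp
  qed
  also have "\<dots> = ((\<Sum>S | S \<subseteq> T \<and> card S = m. 1) - (\<Sum>S | S \<subseteq> T \<and> card S = m. sum q S)) / real (card T) ^ m"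
    by (simp add: sum_divide_distrib[symmetric] sum_subtractf)
  finally show ?thesis
    by (simp add: sum_subsets_card_sum[OF T assms(3)] n_subsets[OF T])
qed

text \<open>
  For \<open>p\<close> uniform on \<open>j\<close> symbols, the penalised functional with penalty weight \<open>2\<kappa>\<close>, where
  \<open>\<kappa> = (b - 1 choose m) / b ^ m\<close>, is at most a quadratic polynomial in the \<open>q\<close>-mass outside the
  support. The inequality below is its discriminant condition for the bound \<open>\<kappa>\<close>, cleared of
  denominators.
\<close>
definition uniform_test :: "nat \<Rightarrow> nat \<Rightarrow> bool" where
  "uniform_test b m \<longleftrightarrow> (\<forall>j\<in>{1..<b}.
     (b - j) * (m * (j choose m) * b ^ m + 2 * ((b - 1) choose m) * j ^ m)\<^sup>2
       + 8 * ((b - 1) choose m) * b * j ^ (m + 1) * ((j - 1) choose m) * b ^ m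
     \<le> 8 * ((b - 1) choose m)\<^sup>2 * b * j ^ (2 * m + 1))"

lemma quadratic_le_of_discriminant:
  fixes a c d z :: real
  assumes "a > 0" "d\<^sup>2 \<le> 4 * a * c"
  shows "d * z - a * z\<^sup>2 \<le> c"
proof -
  have "4 * a * (d * z - a * z\<^sup>2) = d\<^sup>2 - (d - 2 * a * z)\<^sup>2"
    by (simp add: power2_eq_square algebra_simps)
  also have "\<dots> \<le> 4 * a * c" using assms(2) zero_le_power2[of "d - 2 * a * z"] by linarith
  finally show ?thesis using assms(1) by simp
qed

text \<open>By Cauchy-Schwarz on \<open>T\<close> and on \<open>U - T\<close>, the sum of squares of
  \<open>q\<close> is smallest when \<open>q\<close> is constant on each of them, so only the mass
  \<open>Q\<close> of \<open>T\<close> matters. If \<open>T = U\<close>, then \<open>Q = 1\<close>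
  and the penalty is at most 0; otherwise a quadratic in \<open>1 - Q\<close> remains, which
  \<open>uniform_test\<close> controls.\<close>

lemma penalised_uniform_le:
  fixes q :: "'a \<Rightarrow> real"
  assumes "finite U" "card U = b" "m \<ge> 1" "m < b" "uniform_test b m"
    and T: "T \<subseteq> U" "T \<noteq> {}" and q: "sum q U = 1"
  defines "\<kappa> \<equiv> real ((b - 1) choose m) / real b ^ m"
  shows "penalised U m (2 * \<kappa>) (\<lambda>a. if a \<in> T then 1 / card T else 0) q \<le> \<kappa>"
proof -
  define j where "j = card T"
  define Q where "Q = sum q T"
  have fT: "finite T" using T assms(1) finite_subset by blast
  have j: "j \<ge> 1" "j \<le> b" 
    using T fT assms by (auto simp: j_def Suc_le_eq card_gt_0_iff card_mono)
  have \<kappa>: "\<kappa> > 0" using assms(4) by (simp add: \<kappa>_def)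
  have lin: "(\<Sum>a\<in>U. q a * (if a \<in> T then 1 / card T else 0)) = Q / j"
  proof -
    have "(\<Sum>a\<in>U. q a * (if a \<in> T then 1 / card T else 0)) = (\<Sum>a\<in>T. q a / j)"
      using T(1) assms(1) by (subst sum.mono_neutral_right[of U T]) (auto simp: j_def)
    then show ?thesis by (simp add: Q_def sum_divide_distrib)
  qed
  have sq: "(sum q S)\<^sup>2 / card S \<le> (\<Sum>a\<in>S. (q a)\<^sup>2)" if "finite S" for S
  proof (cases "S = {}")
    case False
    then show ?thesis
      using sum_squared_le_sum_of_squares[of q S] that by (simp add: field_simps card_gt_0_iff)
  qed simp
  have pascal: "(j choose m) = ((j - 1) choose (m - 1)) + ((j - 1) choose m)"
    using choose_reduce_nat[of j m] j assms(3) by simp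
  have val: "penalised U m (2 * \<kappa>) (\<lambda>a. if a \<in> T then 1 / card T else 0) q
      = (real (j choose m) - real ((j - 1) choose (m - 1)) * Q) / real j ^ m
        + 2 * \<kappa> * (Q / j - (\<Sum>a\<in>U. (q a)\<^sup>2))"
    unfolding penalised_def esym_deriv_uniform[OF assms(1) T(1) assms(3) q]
    by (simp add: sum_subtractf lin[unfolded j_def] j_def Q_def)
  show ?thesis
  proof (cases "j = b")
    case True
    then have "T = U" using T assms(1,2) by (simp add: card_subset_eq j_def)
    then have "Q = 1" using q by (simp add: Q_def)
    moreover have "1 / b \<le> (\<Sum>a\<in>U. (q a)\<^sup>2)"
      using sq[OF assms(1)] q assms(2) by simp
    ultimately have "2 * \<kappa> * (Q / j - (\<Sum>a\<in>U. (q a)\<^sup>2)) \<le> 0"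
      using \<kappa> True by (simp add: mult_le_0_iff)
    moreover have "(real (j choose m) - real ((j - 1) choose (m - 1)) * Q) / real j ^ m = \<kappa>"
      unfolding \<kappa>_def using pascal True \<open>Q = 1\<close> by simp
    ultimately show ?thesis
      unfolding val by linarith
  next
    case False
    with j have jb: "j < b" by simp
    define X where "X = real ((j - 1) choose (m - 1)) / real j ^ m"
    define Y where "Y = real ((j - 1) choose m) / real j ^ m"
    define z where "z = 1 - Q"
    have sU: "(\<Sum>a\<in>U. (q a)\<^sup>2) \<ge> Q\<^sup>2 / j + z\<^sup>2 / (real b - real j)"
    proof -
      have "(\<Sum>a\<in>U. (q a)\<^sup>2) = (\<Sum>a\<in>T. (q a)\<^sup>2) + (\<Sum>a\<in>U - T. (q a)\<^sup>2)"
        using assms(1) T(1) by (metis add.commute sum.subset_diff)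
      moreover have "card (U - T) = b - j" "sum q (U - T) = z"
        using assms(1,2) T(1) fT q by (auto simp: card_Diff_subset j_def sum_diff z_def Q_def)
      ultimately show ?thesis
        using sq[of T] sq[of "U - T"] fT assms(1) jb by (simp add: Q_def j_def of_nat_diff)
    qed
    have "penalised U m (2 * \<kappa>) (\<lambda>a. if a \<in> T then 1 / card T else 0) q
       \<le> (real (j choose m) - real ((j - 1) choose (m - 1)) * Q) / real j ^ m
          + 2 * \<kappa> * (Q / j - (Q\<^sup>2 / j + z\<^sup>2 / (real b - real j)))"
      unfolding val using sU \<kappa> by (intro add_left_mono mult_left_mono) auto
    \<comment> \<open>Pascal's rule turns the first term into \<open>Y + X * z\<close>, and
      \<open>Q - Q^2 = z - z^2\<close> collects the penalty into a linear and a quadratic term in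
      \<open>z\<close>.\<close>
    also have "\<dots> = Y + ((X + 2 * \<kappa> / j) * z - (2 * \<kappa> * b / (j * (real b - real j))) * z\<^sup>2)"
      unfolding pascal X_def Y_def z_def using j jb
      by (simp add: field_simps power2_eq_square)
    also have "\<dots> \<le> Y + (\<kappa> - Y)"
    proof (intro add_left_mono quadratic_le_of_discriminant)
      show "2 * \<kappa> * b / (j * (real b - real j)) > 0" using \<kappa> j jb by simp
      have test: "(b - j) * (m * (j choose m) * b ^ m + 2 * ((b - 1) choose m) * j ^ m)\<^sup>2
         + 8 * ((b - 1) choose m) * b * j ^ (m + 1) * ((j - 1) choose m) * b ^ m
        \<le> 8 * ((b - 1) choose m)\<^sup>2 * b * j ^ (2 * m + 1)"
        using assms(5) j jb unfolding uniform_test_def by simp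
      \<comment> \<open>In terms of \<kappa>, \<open>X\<close> and \<open>Y\<close>, the integer
        test is the discriminant condition multiplied by \<open>(P * R)^2\<close>, up to factors of
        \<open>j\<close> and \<open>b - j\<close>.\<close>
      define N where "N = real ((b - 1) choose m)"
      define P where "P = real j ^ m"
      define R where "R = real b ^ m"
      have pos: "P > 0" "R > 0" using j jb by (auto simp: P_def R_def)
      have absorb: "real m * real (j choose m) = real j * real ((j - 1) choose (m - 1))"
        using times_binomial_minus1_eq[of m j] assms(3) by (metis of_nat_mult One_nat_def Suc_le_eq)
      have "real ((b - j) * (m * (j choose m) * b ^ m + 2 * ((b - 1) choose m) * j ^ m)\<^sup>2
         + 8 * ((b - 1) choose m) * b * j ^ (m + 1) * ((j - 1) choose m) * b ^ m)
        \<le> real (8 * ((b - 1) choose m)\<^sup>2 * b * j ^ (2 * m + 1))"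
        using test by (simp only: of_nat_le_iff)
      then have "(real b - j) * (real m * real (j choose m) * R + 2 * N * P)\<^sup>2
         + 8 * N * b * (j * P) * (Y * P) * R \<le> 8 * N\<^sup>2 * b * (j * P\<^sup>2)"
        using jb pos(1) by (simp add: of_nat_diff N_def P_def R_def Y_def power_mult power2_eq_square mult_ac power_add)
      moreover have "real m * real (j choose m) = j * X * P"
        using absorb pos(1) by (simp add: X_def P_def)
      moreover have "N = \<kappa> * R" using pos by (simp add: N_def \<kappa>_def R_def)
      ultimately have "(P * R)\<^sup>2 * ((real b - j) * (j * X + 2 * \<kappa>)\<^sup>2 + 8 * \<kappa> * b * j * Y)
          \<le> (P * R)\<^sup>2 * (8 * \<kappa>\<^sup>2 * b * j)"
        by (simp add: algebra_simps power2_eq_square)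
      then have "(real b - j) * (j * X + 2 * \<kappa>)\<^sup>2 + 8 * \<kappa> * b * j * Y \<le> 8 * \<kappa>\<^sup>2 * b * j"
        using pos by (simp add: mult_le_cancel_left_pos)
      then have "(real b - j) * (j * X + 2 * \<kappa>)\<^sup>2 \<le> 8 * \<kappa> * b * j * (\<kappa> - Y)"
        by (simp add: algebra_simps power2_eq_square)
      then have "(j * X + 2 * \<kappa>)\<^sup>2 / (real j)\<^sup>2 \<le> 8 * \<kappa> * b * j * (\<kappa> - Y) / (real b - real j) / (real j)\<^sup>2"
        using jb by (intro divide_right_mono) (simp_all add: field_simps)
      moreover have "(X + 2 * \<kappa> / j)\<^sup>2 = (j * X + 2 * \<kappa>)\<^sup>2 / (real j)\<^sup>2"
        using j by (simp add: power_divide[symmetric] add_divide_distrib)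
      moreover have "4 * (2 * \<kappa> * b / (j * (real b - real j))) * (\<kappa> - Y)
          = 8 * \<kappa> * b * j * (\<kappa> - Y) / (real b - real j) / (real j)\<^sup>2"
        using j jb by (simp add: power2_eq_square mult_ac)
      ultimately show "(X + 2 * \<kappa> / j)\<^sup>2 \<le> 4 * (2 * \<kappa> * b / (j * (real b - real j))) * (\<kappa> - Y)"
        by simp
    qed
    finally show ?thesis by simp
  qed
qed

text \<open>Each penalised value is at most \<kappa>, by passing to a uniform \<open>p\<close> and
  then applying the test. Since \<open>q\<close> is the mean of the \<open>p \<omega>\<close>, the
  mean of their inner products with \<open>q\<close> is the squared norm of \<open>q\<close>, so the
  penalty averages to 0.\<close>

lemma esym_deriv_mean_le:
  fixes p :: "'w \<Rightarrow> 'a \<Rightarrow> real"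
  assumes "finite U" "card U = b" "m \<ge> 2" "m < b" "uniform_test b m"
    and p: "\<And>\<omega> a. \<omega> \<in> \<Omega> \<Longrightarrow> a \<in> U \<Longrightarrow> p \<omega> a \<ge> 0" "\<And>\<omega>. \<omega> \<in> \<Omega> \<Longrightarrow> sum (p \<omega>) U = 1"
    and w: "\<And>\<omega>. \<omega> \<in> \<Omega> \<Longrightarrow> w \<omega> \<ge> 0" "sum w \<Omega> = 1"
    and q: "\<And>a. a \<in> U \<Longrightarrow> q a = (\<Sum>\<omega>\<in>\<Omega>. w \<omega> * p \<omega> a)"
  shows "(\<Sum>\<omega>\<in>\<Omega>. w \<omega> * esym_deriv U m (p \<omega>) q) \<le> real ((b - 1) choose m) / real b ^ m"
proof -
  define \<kappa> where "\<kappa> = real ((b - 1) choose m) / real b ^ m"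
  have \<kappa>: "\<kappa> > 0" using assms(4) by (simp add: \<kappa>_def)
  have "sum q U = (\<Sum>a\<in>U. \<Sum>\<omega>\<in>\<Omega>. w \<omega> * p \<omega> a)" using q by simp
  also have "\<dots> = (\<Sum>\<omega>\<in>\<Omega>. w \<omega> * sum (p \<omega>) U)"
    by (subst sum.swap) (simp add: sum_distrib_left)
  also have "\<dots> = 1" using p(2) w(2) by simp
  finally have sq: "sum q U = 1" .
  have "penalised U m (2 * \<kappa>) (p \<omega>) q \<le> \<kappa>" if in\<Omega>: "\<omega> \<in> \<Omega>" for \<omega>
  proof -
    obtain T q' where "T \<subseteq> U" "T \<noteq> {}" "sum q' U = 1"
      "penalised U m (2 * \<kappa>) (p \<omega>) q \<le> penalised U m (2 * \<kappa>) (\<lambda>a. if a \<in> T then 1 / card T else 0) q'"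
      using penalised_le_uniform[OF assms(1,3) _ p(1)[OF in\<Omega>] p(2)[OF in\<Omega>] sq, of "2 * \<kappa>"] \<kappa> by auto
    moreover have "penalised U m (2 * \<kappa>) (\<lambda>a. if a \<in> T then 1 / card T else 0) q' \<le> \<kappa>"
      unfolding \<kappa>_def using calculation assms by (intro penalised_uniform_le) auto
    ultimately show ?thesis by simp
  qed
  then have "(\<Sum>\<omega>\<in>\<Omega>. w \<omega> * penalised U m (2 * \<kappa>) (p \<omega>) q) \<le> (\<Sum>\<omega>\<in>\<Omega>. w \<omega> * \<kappa>)"
    using w(1) by (intro sum_mono mult_left_mono)
  also have "\<dots> = \<kappa>" using w(2) by (simp add: sum_distrib_right[symmetric])
  also have "(\<Sum>\<omega>\<in>\<Omega>. w \<omega> * penalised U m (2 * \<kappa>) (p \<omega>) q)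
     = (\<Sum>\<omega>\<in>\<Omega>. w \<omega> * esym_deriv U m (p \<omega>) q)
       + 2 * \<kappa> * ((\<Sum>\<omega>\<in>\<Omega>. w \<omega> * (\<Sum>a\<in>U. q a * p \<omega> a)) - (\<Sum>\<omega>\<in>\<Omega>. w \<omega> * (\<Sum>a\<in>U. (q a)\<^sup>2)))"
    unfolding penalised_def
    by (simp add: sum_subtractf algebra_simps sum.distrib sum_distrib_left)
  also have "(\<Sum>\<omega>\<in>\<Omega>. w \<omega> * (\<Sum>a\<in>U. q a * p \<omega> a)) = (\<Sum>a\<in>U. (q a)\<^sup>2)"
  proof -
    have "(\<Sum>\<omega>\<in>\<Omega>. w \<omega> * (\<Sum>a\<in>U. q a * p \<omega> a)) = (\<Sum>a\<in>U. \<Sum>\<omega>\<in>\<Omega>. w \<omega> * (q a * p \<omega> a))"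
      by (subst sum.swap) (simp add: sum_distrib_left)
    also have "\<dots> = (\<Sum>a\<in>U. q a * (\<Sum>\<omega>\<in>\<Omega>. w \<omega> * p \<omega> a))"
      by (simp add: sum_distrib_left mult_ac)
    also have "\<dots> = (\<Sum>a\<in>U. (q a)\<^sup>2)"
      using q by (simp add: power2_eq_square)
    finally show ?thesis .
  qed
  also have "(\<Sum>\<omega>\<in>\<Omega>. w \<omega> * (\<Sum>a\<in>U. (q a)\<^sup>2)) = (\<Sum>a\<in>U. (q a)\<^sup>2)"
    using w(2) by (simp add: sum_distrib_right[symmetric])
  finally show ?thesis by (simp add: \<kappa>_def)
qed

section \<open>Sums over tuples\<close>

lemma sum_tuples_Suc:
  assumes "finite D"
  shows "(\<Sum>xs | length xs = Suc m \<and> set xs \<subseteq> D. f xs)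
       = (\<Sum>x\<in>D. \<Sum>xs | length xs = m \<and> set xs \<subseteq> D. f (x # xs))"
proof -
  have "{xs. length xs = Suc m \<and> set xs \<subseteq> D} = (\<lambda>(x, xs). x # xs) ` (D \<times> {xs. length xs = m \<and> set xs \<subseteq> D})"
    by (auto simp: length_Suc_conv image_iff)
  moreover have "inj_on (\<lambda>(x, xs). x # xs) (D \<times> {xs. length xs = m \<and> set xs \<subseteq> D})"
    by (auto simp: inj_on_def)
  ultimately have "(\<Sum>xs | length xs = Suc m \<and> set xs \<subseteq> D. f xs)
      = (\<Sum>(x, xs)\<in>D \<times> {xs. length xs = m \<and> set xs \<subseteq> D}. f (x # xs))"
    by (simp add: sum.reindex case_prod_unfold)
  also have "\<dots> = (\<Sum>x\<in>D. \<Sum>xs | length xs = m \<and> set xs \<subseteq> D. f (x # xs))"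
    by (rule sum.cartesian_product[symmetric])
  finally show ?thesis .
qed

text \<open>Tuples of elements are grouped by their tuples of symbols; a symbol tuple has as many
  preimages as the product of its fibre sizes.\<close>

lemma sum_tuples_map:
  fixes G :: "'a list \<Rightarrow> real"
  assumes "finite D" "finite U" "h ` D \<subseteq> U"
  shows "(\<Sum>xs | length xs = m \<and> set xs \<subseteq> D. G (map h xs))
       = (\<Sum>as | length as = m \<and> set as \<subseteq> U. prod_list (map (\<lambda>a. real (card {x \<in> D. h x = a})) as) * G as)"
proof (induction m arbitrary: G)
  case 0
  then show ?case by (simp cong: conj_cong)
next
  case (Suc m)
  define N where "N a = real (card {x \<in> D. h x = a})" for a
  define F where "F a = (\<Sum>as | length as = m \<and> set as \<subseteq> U. prod_list (map N as) * G (a # as))" for a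
  have "(\<Sum>xs | length xs = Suc m \<and> set xs \<subseteq> D. G (map h xs)) = (\<Sum>x\<in>D. F (h x))"
    unfolding sum_tuples_Suc[OF assms(1)] F_def N_def using Suc.IH[of "\<lambda>as. G (_ # as)"] by simp
  also have "\<dots> = (\<Sum>a\<in>U. \<Sum>x | x \<in> D \<and> h x = a. F (h x))"
    by (rule sum.group[OF assms, symmetric])
  also have "\<dots> = (\<Sum>a\<in>U. N a * F a)"
    by (intro sum.cong refl) (simp add: N_def)
  also have "\<dots> = (\<Sum>as | length as = Suc m \<and> set as \<subseteq> U. prod_list (map N as) * G as)"
    unfolding sum_tuples_Suc[OF assms(2)] F_def by (simp add: sum_distrib_left mult_ac)
  finally show ?case by (simp add: N_def[abs_def])
qed

lemma sum_distinct_tuples: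
  fixes p :: "'a \<Rightarrow> real"
  assumes "finite U"
  shows "(\<Sum>as | length as = m \<and> set as \<subseteq> U. prod_list (map p as) * (if distinct as then H (set as) else 0))
       = fact m * (\<Sum>T | T \<subseteq> U \<and> card T = m. prod p T * H T)"
proof -
  let ?X = "{as. length as = m \<and> set as \<subseteq> U \<and> distinct as}"
  have fin: "finite {as. length as = m \<and> set as \<subseteq> U}"
    using finite_lists_length_eq[OF assms, of m] by (simp add: conj_commute)
  have "(\<Sum>as | length as = m \<and> set as \<subseteq> U. prod_list (map p as) * (if distinct as then H (set as) else 0))
      = (\<Sum>as\<in>?X. prod p (set as) * H (set as))"
    using fin by (intro sum.mono_neutral_cong_right) (auto simp: prod.distinct_set_conv_list)
  also have "\<dots> = (\<Sum>T | T \<subseteq> U \<and> card T = m. \<Sum>as | as \<in> ?X \<and> set as = T. prod p (set as) * H (set as))"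
  proof (rule sum.group[symmetric])
    show "finite ?X" by (rule finite_subset[OF _ fin]) auto
  qed (use assms in \<open>auto simp: distinct_card\<close>)
  also have "\<dots> = (\<Sum>T | T \<subseteq> U \<and> card T = m. fact m * (prod p T * H T))"
  proof (intro sum.cong refl)
    fix T assume "T \<in> {T. T \<subseteq> U \<and> card T = m}"
    then have T: "T \<subseteq> U" "card T = m" "finite T" using assms finite_subset by auto
    have eq: "{as. as \<in> ?X \<and> set as = T} = {xs. length xs = m \<and> distinct xs \<and> set xs \<subseteq> T}"
      using T by (auto simp: distinct_card intro: card_subset_eq[THEN equalityD2, THEN subsetD])
    have "card {as. as \<in> ?X \<and> set as = T} = fact m"
      unfolding eq card_lists_distinct_length_eq[OF T(3), of m, unfolded T(2), OF order_refl]
      by (simp add: fact_prod)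
    then show "(\<Sum>as | as \<in> ?X \<and> set as = T. prod p (set as) * H (set as)) = fact m * (prod p T * H T)"
      by (simp add: sum.cong[of _ _ "\<lambda>as. prod p (set as) * H (set as)" "\<lambda>_. prod p T * H T"])
  qed
  finally show ?thesis by (simp add: sum_distrib_left)
qed

text \<open>A crude birthday bound: sampling \<open>m\<close> elements of \<open>D\<close>
  independently gives a repetition with probability at most \<open>m^2 / card D\<close>.
  Inductively, either the tail already has a repetition or the head is one of the \<open>m\<close>
  tail entries.\<close>

lemma card_nondistinct_tuples:
  assumes "finite D"
  shows "card D * card {xs. length xs = m \<and> set xs \<subseteq> D \<and> \<not> distinct xs} \<le> m\<^sup>2 * card D ^ m"
proof (induction m)
  case 0
  then show ?case by (simp add: card_eq_0_iff)
next
  case (Suc m)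
  let ?N = "\<lambda>m. {xs. length xs = m \<and> set xs \<subseteq> D \<and> \<not> distinct xs}"
  let ?L = "{xs. length xs = m \<and> set xs \<subseteq> D}"
  have fin: "finite ?L" using finite_lists_length_eq[OF assms, of m] by (simp add: conj_commute)
  have finN: "finite (?N m)" by (rule finite_subset[OF _ fin]) auto
  have cL: "card ?L = card D ^ m"
    using card_lists_length_eq[OF assms, of m] by (simp add: conj_commute)
  have "?N (Suc m) \<subseteq> (\<lambda>(x, xs). x # xs) ` (D \<times> ?N m) \<union> (\<lambda>(xs, j). xs ! j # xs) ` (?L \<times> {..<m})"
  proof
    fix ys assume "ys \<in> ?N (Suc m)"
    then obtain x xs where ys: "ys = x # xs" "length xs = m" "x \<in> D" "set xs \<subseteq> D" "x \<in> set xs \<or> \<not> distinct xs"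
      by (cases ys) auto
    then show "ys \<in> (\<lambda>(x, xs). x # xs) ` (D \<times> ?N m) \<union> (\<lambda>(xs, j). xs ! j # xs) ` (?L \<times> {..<m})"
    proof (cases "distinct xs")
      case True
      then obtain j where "j < m" "xs ! j = x" using ys by (auto simp: in_set_conv_nth)
      then have "ys = (\<lambda>(xs, j). xs ! j # xs) (xs, j)" "(xs, j) \<in> ?L \<times> {..<m}" using ys by auto
      then show ?thesis by blast
    next
      case False
      then have "ys = (\<lambda>(x, xs). x # xs) (x, xs)" "(x, xs) \<in> D \<times> ?N m" using ys by auto
      then show ?thesis by blast
    qed
  qed
  then have "card (?N (Suc m)) \<le> card ((\<lambda>(x, xs). x # xs) ` (D \<times> ?N m) \<union> (\<lambda>(xs, j). xs ! j # xs) ` (?L \<times> {..<m}))"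
    using assms fin finN by (intro card_mono) auto
  also have "\<dots> \<le> card (D \<times> ?N m) + card (?L \<times> {..<m})"
    using assms fin finN by (intro order_trans[OF card_Un_le] add_mono card_image_le) auto
  also have "\<dots> = card D * card (?N m) + card D ^ m * m"
    by (simp add: card_cartesian_product cL)
  also have "\<dots> \<le> m\<^sup>2 * card D ^ m + card D ^ m * m"
    using Suc.IH by simp
  also have "\<dots> \<le> (Suc m)\<^sup>2 * card D ^ m"
    by (simp add: power2_eq_square algebra_simps)
  finally have "card D * card (?N (Suc m)) \<le> card D * ((Suc m)\<^sup>2 * card D ^ m)"
    by (rule mult_left_mono) simp
  then show ?case by (simp add: mult_ac)
qed

lemma esym_deriv_scale:
  "esym_deriv U m (\<lambda>a. c * p a) (\<lambda>a. d * q a) = c ^ m * d * esym_deriv U m p q"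
  unfolding esym_deriv_def sum_distrib_left
  by (intro sum.cong refl) (simp add: prod.distrib sum_distrib_left[symmetric])

text \<open>With counts in place of probabilities, this is the total contribution of one coordinate
  to Hansel's bound over all \<open>m\<close>-tuples from \<open>D\<close>, repetitions
  included.\<close>

lemma sum_tuples_separating:
  fixes h :: "'v \<Rightarrow> 'a"
  assumes "finite D" "finite C" "finite U" "h ` D \<subseteq> U" "h ` C \<subseteq> U"
  shows "(\<Sum>xs | length xs = m \<and> set xs \<subseteq> D.
            if distinct (map h xs) then real (card {y \<in> C. h y \<in> U - set (map h xs)}) else 0)
       = fact m * esym_deriv U m (\<lambda>a. real (card {x \<in> D. h x = a})) (\<lambda>a. real (card {x \<in> C. h x = a}))"
proof -
  have "real (card {y \<in> C. h y \<in> U - T}) = (\<Sum>a\<in>U - T. real (card {x \<in> C. h x = a}))" for T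
  proof -
    have "card {y \<in> C. h y \<in> U - T} = (\<Sum>y\<in>{y \<in> C. h y \<in> U - T}. 1)" by simp
    also have "\<dots> = (\<Sum>a\<in>U - T. \<Sum>y | y \<in> {y \<in> C. h y \<in> U - T} \<and> h y = a. 1)"
      using assms by (intro sum.group[symmetric]) auto
    also have "\<dots> = (\<Sum>a\<in>U - T. card {x \<in> C. h x = a})"
      by (intro sum.cong refl) (auto intro!: arg_cong[where f = card])
    finally show ?thesis by simp
  qed
  then show ?thesis
    using sum_tuples_map[OF assms(1,3,4), where m = m and G = "\<lambda>as. if distinct as then real (card {y \<in> C. h y \<in> U - set as}) else 0"]
      sum_distinct_tuples[OF assms(3), where H = "\<lambda>T. real (card {y \<in> C. h y \<in> U - T})"]
    by (simp add: esym_deriv_def)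
qed

section \<open>Random cells and the size of a hash code\<close>

text \<open>For distinct \<open>y\<close> and \<open>z\<close> outside \<open>xs\<close>, the hash
  property of these \<open>m + 2\<close> codewords gives a coordinate where all are distinct. There
  \<open>xs\<close> uses \<open>m\<close> symbols, and \<open>y\<close> and \<open>z\<close> receive
  different colours among the other \<open>b - m\<close>.\<close>

lemma Hansel_hash_code:
  assumes code: "hash_code b (m + 2) n C" and fin: "finite C" and "m + 1 \<le> b" "m < card C"
    and xs: "length xs = m" "set xs \<subseteq> C" "distinct xs"
  shows "real (card C - m) * ln (real (card C - m)) \<le> ln (real (b - m)) *
    (\<Sum>i<n. if distinct (map (\<lambda>w. w ! i) xs)
       then real (card {y \<in> C. y ! i \<in> {1..b} - set (map (\<lambda>w. w ! i) xs)}) else 0)"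
proof -
  \<comment> \<open>The empty palette where symbols of \<open>xs\<close> collide leaves every
    codeword uncoloured, so such coordinates contribute nothing.\<close>
  define S where "S i = (if distinct (map (\<lambda>w. w ! i) xs) then {1..b} - set (map (\<lambda>w. w ! i) xs) else {})" for i
  have C: "C \<subseteq> words b n" using code by (simp add: hash_code_def)
  have coord: "w ! i \<in> {1..b}" if "w \<in> C" "i < n" for w i
    using C that by (force simp: words_def)
  have V: "card (C - set xs) = card C - m"
    using xs fin by (simp add: card_Diff_subset distinct_card)
  have "real (card (C - set xs)) * ln (card (C - set xs))
      \<le> ln (real (b - m)) * real (\<Sum>i<n. card {y \<in> C - set xs. y ! i \<in> S i})"
  proof (rule Hansel_partial_colouring)
    fix i assume i: "i < n"
    have "set (map (\<lambda>w. w ! i) xs) \<subseteq> {1..b}"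
      using coord[OF _ i] xs(2) by auto
    then show "card (S i) \<le> b - m"
      using xs(1) by (auto simp: S_def card_Diff_subset distinct_card simp del: set_map)
  next
    fix y z assume yz: "y \<in> C - set xs" "z \<in> C - set xs" "y \<noteq> z"
    let ?K = "insert y (insert z (set xs))"
    have "card ?K = m + 2" "?K \<subseteq> C"
      using yz xs by (auto simp: distinct_card)
    then obtain i where i: "i < n" "inj_on (\<lambda>w. w ! i) ?K"
      using code unfolding hash_code_def by blast
    have "distinct (map (\<lambda>w. w ! i) xs)"
      using i(2) xs(3) by (auto simp: distinct_map intro: inj_on_subset)
    moreover have "y ! i \<notin> set (map (\<lambda>w. w ! i) xs)" "z ! i \<notin> set (map (\<lambda>w. w ! i) xs)" "y ! i \<noteq> z ! i"
      using i(2) yz by (auto simp: inj_on_def)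
    ultimately show "\<exists>i<n. y ! i \<in> S i \<and> z ! i \<in> S i \<and> y ! i \<noteq> z ! i"
      using i(1) yz coord[of y i] coord[of z i] by (intro exI[of _ i]) (auto simp: S_def)
  qed (use fin assms(3) in \<open>auto simp: S_def\<close>)
  also have "\<dots> \<le> ln (real (b - m)) * (\<Sum>i<n. if distinct (map (\<lambda>w. w ! i) xs)
       then real (card {y \<in> C. y ! i \<in> {1..b} - set (map (\<lambda>w. w ! i) xs)}) else 0)"
  proof (rule mult_left_mono)
    show "real (\<Sum>i<n. card {y \<in> C - set xs. y ! i \<in> S i}) \<le> (\<Sum>i<n. if distinct (map (\<lambda>w. w ! i) xs)
       then real (card {y \<in> C. y ! i \<in> {1..b} - set (map (\<lambda>w. w ! i) xs)}) else 0)"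
      unfolding of_nat_sum using fin by (intro sum_mono) (auto simp: S_def intro!: card_mono)
    show "0 \<le> ln (real (b - m))" using assms(3) by simp
  qed
  finally show ?thesis unfolding V .
qed

section \<open>Uniformly random cells\<close>

lemma card_subsets_containing:
  assumes "finite U" "a \<in> U" "r \<ge> 1"
  shows "card {A. A \<subseteq> U \<and> card A = r \<and> a \<in> A} = (card U - 1) choose (r - 1)"
proof -
  have "(\<Sum>A | A \<subseteq> U \<and> card A = r. sum (\<lambda>x. if x = a then 1 else 0 :: real) A)
      = (\<Sum>A | A \<subseteq> U \<and> card A = r. if a \<in> A then 1 else 0 :: real)"
    using assms(1) by (intro sum.cong[OF refl]) (auto dest: finite_subset)
  also have "\<dots> = real (card {A. A \<subseteq> U \<and> card A = r \<and> a \<in> A})"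
    using assms(1) by (simp add: sum.If_cases Int_def conj_assoc)
  finally show ?thesis
    using sum_subsets_card_sum[OF assms(1,3), of "\<lambda>x. if x = a then 1 else 0"] assms(1,2) by simp
qed

text \<open>Extensional functions make the set of cells finite, so that random choices become
  counting. It is applied with \<open>r = m - 1\<close>, one symbol too few for \<open>m\<close>
  codewords of a cell to be distinct in any of the first \<open>n0\<close> coordinates.\<close>

definition cell_choices :: "nat \<Rightarrow> nat \<Rightarrow> nat \<Rightarrow> (nat \<Rightarrow> nat set) set" where
  "cell_choices b r n0 = ({..<n0} \<rightarrow>\<^sub>E {A. A \<subseteq> {1..b} \<and> card A = r})"

definition in_cell :: "nat \<Rightarrow> (nat \<Rightarrow> nat set) \<Rightarrow> nat list \<Rightarrow> bool" where
  "in_cell n0 \<omega> x \<longleftrightarrow> (\<forall>i<n0. x ! i \<in> \<omega> i)"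

lemma finite_cell_choices: "finite (cell_choices b r n0)"
  unfolding cell_choices_def by (intro finite_PiE) auto

lemma card_cell_choices: "card (cell_choices b r n0) = (b choose r) ^ n0"
  unfolding cell_choices_def by (subst card_PiE) (auto simp: n_subsets)

lemma card_cells_containing:
  assumes "r \<ge> 1" "\<And>i. i < n0 \<Longrightarrow> x ! i \<in> {1..b}"
  shows "card {\<omega> \<in> cell_choices b r n0. in_cell n0 \<omega> x} = ((b - 1) choose (r - 1)) ^ n0"
proof -
  have "{\<omega> \<in> cell_choices b r n0. in_cell n0 \<omega> x}
      = (\<Pi>\<^sub>E i\<in>{..<n0}. {A. A \<subseteq> {1..b} \<and> card A = r \<and> x ! i \<in> A})"
    by (rule set_eqI) (simp add: cell_choices_def in_cell_def PiE_iff, blast)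
  then show ?thesis
    using assms card_subsets_containing[of "{1..b}" _ r] by (simp add: card_PiE)
qed

text \<open>The number of cells containing a codeword does not depend on the codeword, so summing
  over cells counts each codeword equally often.\<close>

lemma sum_card_cells:
  assumes "finite D" "r \<ge> 1" "\<And>x i. x \<in> D \<Longrightarrow> i < n0 \<Longrightarrow> x ! i \<in> {1..b}"
  shows "(\<Sum>\<omega>\<in>cell_choices b r n0. card {x \<in> D. in_cell n0 \<omega> x}) = ((b - 1) choose (r - 1)) ^ n0 * card D"
proof -
  have "(\<Sum>\<omega>\<in>cell_choices b r n0. card {x \<in> D. in_cell n0 \<omega> x})
      = (\<Sum>\<omega>\<in>cell_choices b r n0. \<Sum>x\<in>D. if in_cell n0 \<omega> x then 1 else 0)"
    using assms(1) by (simp add: sum.If_cases Int_def)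
  also have "\<dots> = (\<Sum>x\<in>D. \<Sum>\<omega>\<in>cell_choices b r n0. if in_cell n0 \<omega> x then 1 else 0)"
    by (rule sum.swap)
  also have "\<dots> = (\<Sum>x\<in>D. card {\<omega> \<in> cell_choices b r n0. in_cell n0 \<omega> x})"
    by (simp add: sum.If_cases Int_def finite_cell_choices)
  also have "\<dots> = (\<Sum>x\<in>D. ((b - 1) choose (r - 1)) ^ n0)"
    by (intro sum.cong[OF refl] card_cells_containing assms)
  finally show ?thesis by simp
qed

lemma cell_not_distinct:
  assumes "\<omega> \<in> cell_choices b r n0" "\<And>x. x \<in> set xs \<Longrightarrow> in_cell n0 \<omega> x" "i < n0" "r < length xs"
  shows "\<not> distinct (map (\<lambda>w. w ! i) xs)"
proof
  assume "distinct (map (\<lambda>w. w ! i) xs)"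
  then have "card (set (map (\<lambda>w. w ! i) xs)) = length xs"
    by (metis distinct_card length_map)
  moreover have "set (map (\<lambda>w. w ! i) xs) \<subseteq> \<omega> i"
    using assms(2,3) by (auto simp: in_cell_def)
  moreover have "\<omega> i \<subseteq> {1..b}" "card (\<omega> i) = r"
    using assms(1,3) by (auto simp: cell_choices_def PiE_iff)
  moreover have "finite (\<omega> i)"
    using finite_subset[OF \<open>\<omega> i \<subseteq> {1..b}\<close>] by simp
  ultimately show False
    using assms(4) card_mono[of "\<omega> i"] by (metis not_le)
qed

text \<open>Hansel's bound is averaged over the distinct \<open>m\<close>-tuples of a cell, and then
  over cells weighted by their number of codewords. The first \<open>n0\<close> coordinates
  contribute nothing and every other one at most \<open>M * fact m * \<kappa>\<close>. The factor
  with \<open>(b / (m - 1)) ^ n0 / M\<close> pays for tuples with repetitions, and is close to 1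
  when cells contain many codewords on average.\<close>

lemma hash_code_size_bound:
  assumes code: "hash_code b (m + 2) n C" and fin: "finite C"
    and m: "m \<ge> 2" "m < b" "m < card C" and test: "uniform_test b m" and n0: "n0 \<le> n"
  defines "M \<equiv> card C"
  shows "(real M - m) * ln (real M - m) * (1 - m\<^sup>2 * (b / (real m - 1)) ^ n0 / M)
    \<le> ln (real b - m) * M * (fact m * real ((b - 1) choose m) / real b ^ m) * (real n - n0)"
proof -
  define U where "U = {1..b}"
  have U: "finite U" "card U = b" by (auto simp: U_def)
  define \<kappa> where "\<kappa> = real ((b - 1) choose m) / real b ^ m"
  define Lam where "Lam = real (M - m) * ln (real (M - m))"
  \<comment> \<open>Empty cells are left out so that \<open>p\<close> can be normalised by the cell
    size \<open>d\<close>.\<close>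
  define \<Omega> where "\<Omega> = {\<omega> \<in> cell_choices b (m - 1) n0. {x \<in> C. in_cell n0 \<omega> x} \<noteq> {}}"
  define D where "D \<omega> = {x \<in> C. in_cell n0 \<omega> x}" for \<omega>
  define d where "d \<omega> = real (card (D \<omega>))" for \<omega>
  define \<beta> where "\<beta> = ((b - 1) choose (m - 2)) ^ n0"
  define S where "S = real \<beta> * M"
  \<comment> \<open>Every codeword lies in \<beta> cells, so \<open>S\<close> is the sum of all cell
    sizes and \<open>w\<close> a probability. Weighting by size makes \<open>q i\<close> the mean of
    the \<open>p i \<omega>\<close>.\<close>
  define w where "w \<omega> = d \<omega> / S" for \<omega>
  define p where "p i \<omega> a = card {x \<in> D \<omega>. x ! i = a} / d \<omega>" for i \<omega> a
  define q where "q i a = real (card {x \<in> C. x ! i = a}) / M" for i a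
  define K where "K i xs = (if distinct (map (\<lambda>w. w ! i) xs)
       then real (card {y \<in> C. y ! i \<in> U - set (map (\<lambda>w. w ! i) xs)}) else 0)" for i xs
  let ?tuples = "\<lambda>\<omega>. {xs. length xs = m \<and> set xs \<subseteq> D \<omega>}"
  have C: "C \<subseteq> words b n" using code by (simp add: hash_code_def)
  have coord: "x ! i \<in> U" if "x \<in> C" "i < n" for x i
    using C that by (force simp: words_def U_def)
  have finD: "finite (D \<omega>)" for \<omega> using fin by (simp add: D_def)
  have d: "d \<omega> > 0" if "\<omega> \<in> \<Omega>" for \<omega>
    using that finD[of \<omega>] by (auto simp: d_def D_def \<Omega>_def card_gt_0_iff)
  have M: "M > 0" "M > m" using m by (auto simp: M_def)
  have "m - 2 \<le> b - 1" using m by linarith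
  then have \<beta>: "\<beta> > 0" by (simp add: \<beta>_def)
  have S: "S > 0" using M \<beta> by (simp add: S_def)
  have Lam: "Lam \<ge> 0" using M by (simp add: Lam_def)

  have count: "(\<Sum>\<omega>\<in>\<Omega>. real (card {x \<in> D \<omega>. P x})) = \<beta> * card {x \<in> C. P x}" for P
  proof -
    have "(\<Sum>\<omega>\<in>\<Omega>. card {x \<in> D \<omega>. P x}) = (\<Sum>\<omega>\<in>cell_choices b (m - 1) n0. card {x \<in> {x \<in> C. P x}. in_cell n0 \<omega> x})"
    proof (rule sum.mono_neutral_cong_left)
      show "\<forall>\<omega>\<in>cell_choices b (m - 1) n0 - \<Omega>. card {x \<in> {x \<in> C. P x}. in_cell n0 \<omega> x} = 0"
        by (auto simp: \<Omega>_def card_gt_0_iff)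
      show "card {x \<in> D \<omega>. P x} = card {x \<in> {x \<in> C. P x}. in_cell n0 \<omega> x}" for \<omega>
        unfolding D_def by (rule arg_cong[where f = card]) auto
    qed (auto simp: \<Omega>_def finite_cell_choices)
    also have "\<dots> = ((b - 1) choose (m - 1 - 1)) ^ n0 * card {x \<in> C. P x}"
      by (rule sum_card_cells) (use fin m coord n0 in \<open>auto simp: U_def\<close>)
    also have "m - 1 - 1 = m - 2" by simp
    finally have "(\<Sum>\<omega>\<in>\<Omega>. card {x \<in> D \<omega>. P x}) = \<beta> * card {x \<in> C. P x}"
      by (simp only: \<beta>_def)
    then have "real (\<Sum>\<omega>\<in>\<Omega>. card {x \<in> D \<omega>. P x}) = real (\<beta> * card {x \<in> C. P x})"
      by (simp only:)
    then show ?thesis by (simp only: of_nat_sum of_nat_mult)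
  qed
  have w1: "sum w \<Omega> = 1"
    using count[of "\<lambda>_. True"] \<beta> M(1) by (simp add: w_def d_def S_def M_def sum_divide_distrib[symmetric])
  have q: "q i a = (\<Sum>\<omega>\<in>\<Omega>. w \<omega> * p i \<omega> a)" for i a
  proof -
    have "(\<Sum>\<omega>\<in>\<Omega>. w \<omega> * p i \<omega> a) = (\<Sum>\<omega>\<in>\<Omega>. card {x \<in> D \<omega>. x ! i = a} / S)"
      using d by (intro sum.cong[OF refl]) (force simp: w_def p_def)
    also have "\<dots> = \<beta> * card {x \<in> C. x ! i = a} / S"
      by (simp add: sum_divide_distrib[symmetric] count)
    finally show ?thesis using \<beta> by (simp add: S_def q_def)
  qed
  have mean: "(\<Sum>\<omega>\<in>\<Omega>. w \<omega> * esym_deriv U m (p i \<omega>) (q i)) \<le> \<kappa>" if i: "i < n" for i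
    unfolding \<kappa>_def
  proof (rule esym_deriv_mean_le[OF U m(1,2) test])
    fix \<omega> assume \<omega>: "\<omega> \<in> \<Omega>"
    have "(\<Sum>a\<in>U. \<Sum>x | x \<in> D \<omega> \<and> x ! i = a. 1 :: real) = (\<Sum>x\<in>D \<omega>. 1)"
      by (rule sum.group[OF finD U(1)]) (use coord[OF _ i] in \<open>auto simp: D_def\<close>)
    then show "sum (p i \<omega>) U = 1"
      using d[OF \<omega>] by (simp add: p_def sum_divide_distrib[symmetric] d_def)
  qed (use d S w1 q in \<open>auto simp: p_def d_def w_def\<close>)

  have early: "K i xs = 0" if "\<omega> \<in> \<Omega>" "xs \<in> ?tuples \<omega>" "i < n0" for \<omega> xs i
  proof -
    have "\<not> distinct (map (\<lambda>w. w ! i) xs)"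
      using that m by (intro cell_not_distinct[of \<omega> b "m - 1" n0]) (auto simp: \<Omega>_def D_def)
    then show ?thesis by (simp add: K_def)
  qed
  have Ksum: "(\<Sum>xs\<in>?tuples \<omega>. K i xs) = d \<omega> ^ m * M * fact m * esym_deriv U m (p i \<omega>) (q i)"
    if "\<omega> \<in> \<Omega>" "i < n" for \<omega> i
  proof -
    have "(\<Sum>xs\<in>?tuples \<omega>. K i xs)
        = fact m * esym_deriv U m (\<lambda>a. real (card {x \<in> D \<omega>. x ! i = a})) (\<lambda>a. real (card {x \<in> C. x ! i = a}))"
      unfolding K_def by (rule sum_tuples_separating) (use finD fin U coord[OF _ that(2)] in \<open>auto simp: D_def\<close>)
    also have "(\<lambda>a. real (card {x \<in> D \<omega>. x ! i = a})) = (\<lambda>a. d \<omega> * p i \<omega> a)"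
      using d[OF that(1)] by (simp add: p_def)
    also have "(\<lambda>a. real (card {x \<in> C. x ! i = a})) = (\<lambda>a. real M * q i a)"
      using M by (simp add: q_def)
    finally show ?thesis by (simp add: esym_deriv_scale)
  qed
  have cell: "Lam * (w \<omega> - m\<^sup>2 / S) \<le> ln (real (b - m)) * (M * fact m * (\<Sum>i\<in>{n0..<n}. w \<omega> * esym_deriv U m (p i \<omega>) (q i)))"
    if \<omega>: "\<omega> \<in> \<Omega>" for \<omega>
  proof -
    let ?nd = "{xs. length xs = m \<and> set xs \<subseteq> D \<omega> \<and> \<not> distinct xs}"
    have ft: "finite (?tuples \<omega>)" using finite_lists_length_eq[OF finD, of \<omega> m] by (simp add: conj_commute)
    have ct: "real (card (?tuples \<omega>)) = d \<omega> ^ m"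
      using card_lists_length_eq[OF finD, of \<omega> m] by (simp add: conj_commute d_def)
    have "real (card (D \<omega>) * card ?nd) \<le> real (m\<^sup>2 * card (D \<omega>) ^ m)"
      using card_nondistinct_tuples[OF finD, of \<omega> m] by (simp only: of_nat_le_iff)
    then have "d \<omega> * card ?nd \<le> m\<^sup>2 * d \<omega> ^ m"
      by (simp add: d_def)
    then have nd: "d \<omega> * card ?nd / d \<omega> ^ m \<le> m\<^sup>2"
      using d[OF \<omega>] by (simp add: field_simps)
    have "Lam * (d \<omega> ^ m - card ?nd) = Lam * card (?tuples \<omega> - ?nd)"
    proof -
      have "card (?tuples \<omega> - ?nd) = card (?tuples \<omega>) - card ?nd" "card ?nd \<le> card (?tuples \<omega>)"
        using ft by (auto intro!: card_Diff_subset card_mono intro: finite_subset[OF _ ft])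
      then show ?thesis using ct by (simp add: of_nat_diff)
    qed
    also have "\<dots> = (\<Sum>xs\<in>?tuples \<omega> - ?nd. Lam)" by simp
    also have "\<dots> \<le> (\<Sum>xs\<in>?tuples \<omega> - ?nd. ln (real (b - m)) * (\<Sum>i<n. K i xs))"
    proof (rule sum_mono)
      fix xs assume "xs \<in> ?tuples \<omega> - ?nd"
      then have "length xs = m" "set xs \<subseteq> C" "distinct xs" by (auto simp: D_def)
      then show "Lam \<le> ln (real (b - m)) * (\<Sum>i<n. K i xs)"
        using Hansel_hash_code[OF code fin _ m(3), of xs] m unfolding Lam_def M_def K_def U_def by simp
    qed
    \<comment> \<open>Tuples with repetitions may be restored on this side, where all terms are
      nonnegative; the sum over all tuples is the one known exactly from
      \<open>Ksum\<close>.\<close>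
    also have "\<dots> \<le> (\<Sum>xs\<in>?tuples \<omega>. ln (real (b - m)) * (\<Sum>i<n. K i xs))"
      using ft m by (intro sum_mono2) (auto intro!: mult_nonneg_nonneg sum_nonneg simp: K_def)
    also have "\<dots> = ln (real (b - m)) * (\<Sum>i<n. \<Sum>xs\<in>?tuples \<omega>. K i xs)"
      unfolding sum_distrib_left[symmetric] by (subst sum.swap) (rule refl)
    also have "(\<Sum>i<n. \<Sum>xs\<in>?tuples \<omega>. K i xs) = (\<Sum>i\<in>{n0..<n}. \<Sum>xs\<in>?tuples \<omega>. K i xs)"
      by (rule sum.mono_neutral_right) (use early[OF \<omega>] in \<open>auto intro!: sum.neutral\<close>)
    also have "\<dots> = (\<Sum>i\<in>{n0..<n}. d \<omega> ^ m * M * fact m * esym_deriv U m (p i \<omega>) (q i))"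
      by (rule sum.cong[OF refl]) (use Ksum[OF \<omega>] in auto)
    also have "\<dots> = d \<omega> ^ m * (M * fact m * (\<Sum>i\<in>{n0..<n}. esym_deriv U m (p i \<omega>) (q i)))"
      by (simp add: sum_distrib_left mult_ac)
    finally have "(w \<omega> / d \<omega> ^ m) * (Lam * (d \<omega> ^ m - card ?nd))
        \<le> (w \<omega> / d \<omega> ^ m) * (ln (real (b - m)) * (d \<omega> ^ m * (M * fact m * (\<Sum>i\<in>{n0..<n}. esym_deriv U m (p i \<omega>) (q i)))))"
      using d[OF \<omega>] S by (intro mult_left_mono) (auto simp: w_def)
    also have "\<dots> = ln (real (b - m)) * (M * fact m * (\<Sum>i\<in>{n0..<n}. w \<omega> * esym_deriv U m (p i \<omega>) (q i)))"
      using d[OF \<omega>] by (simp add: sum_distrib_left[symmetric])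
    finally have "(w \<omega> / d \<omega> ^ m) * (Lam * (d \<omega> ^ m - card ?nd)) \<le> \<dots>" .
    \<comment> \<open>As \<open>w \<omega> = d \<omega> / S\<close>, the birthday bound makes the
      loss at most \<open>m^2 / S\<close>, the same for every cell.\<close>
    moreover have "(w \<omega> / d \<omega> ^ m) * (Lam * (d \<omega> ^ m - card ?nd)) = Lam * (w \<omega> - d \<omega> * card ?nd / d \<omega> ^ m / S)"
      using d[OF \<omega>] S by (simp add: w_def field_simps)
    moreover have "Lam * (w \<omega> - m\<^sup>2 / S) \<le> Lam * (w \<omega> - d \<omega> * card ?nd / d \<omega> ^ m / S)"
      using Lam divide_right_mono[OF nd, of S] S by (intro mult_left_mono) auto
    ultimately show ?thesis by linarith
  qed
  \<comment> \<open>The losses add up to at most \<open>m^2\<close> times the number of cells over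
    \<open>S\<close>, and the ratio of \<open>b choose (m - 1)\<close> to
    \<open>(b - 1) choose (m - 2)\<close> is \<open>b / (m - 1)\<close>.\<close>
  have "Lam * (1 - m\<^sup>2 * (b / (real m - 1)) ^ n0 / M) \<le> Lam * (\<Sum>\<omega>\<in>\<Omega>. w \<omega> - m\<^sup>2 / S)"
  proof (rule mult_left_mono[OF _ Lam])
    have "card \<Omega> \<le> (b choose (m - 1)) ^ n0"
      unfolding card_cell_choices[symmetric] by (rule card_mono) (auto simp: \<Omega>_def finite_cell_choices)
    then have c: "real (card \<Omega>) \<le> real (b choose (m - 1)) ^ n0"
      by (simp only: of_nat_le_iff of_nat_power[symmetric])
    have "(m - 1) * (b choose (m - 1)) = b * ((b - 1) choose (m - 1 - 1))"
      using m by (intro times_binomial_minus1_eq) auto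
    also have "m - 1 - 1 = m - 2" by simp
    finally have "real (m - 1) * real (b choose (m - 1)) = real b * real ((b - 1) choose (m - 2))"
      by (simp only: of_nat_mult[symmetric])
    then have "b / (real m - 1) = real (b choose (m - 1)) / real ((b - 1) choose (m - 2))"
      using m by (simp add: field_simps of_nat_diff)
    then have "(b / (real m - 1)) ^ n0 = real (b choose (m - 1)) ^ n0 / \<beta>"
      by (simp add: \<beta>_def power_divide)
    then have "m\<^sup>2 * (b / (real m - 1)) ^ n0 / M = m\<^sup>2 * real (b choose (m - 1)) ^ n0 / S"
      by (simp add: S_def)
    also have "\<dots> \<ge> m\<^sup>2 * card \<Omega> / S"
      using mult_left_mono[OF c, of "(real m)\<^sup>2"] S by (intro divide_right_mono) auto
    finally show "1 - m\<^sup>2 * (b / (real m - 1)) ^ n0 / M \<le> (\<Sum>\<omega>\<in>\<Omega>. w \<omega> - m\<^sup>2 / S)"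
      by (simp add: sum_subtractf w1 mult.commute)
  qed
  also have "\<dots> \<le> (\<Sum>\<omega>\<in>\<Omega>. ln (real (b - m)) * (M * fact m * (\<Sum>i\<in>{n0..<n}. w \<omega> * esym_deriv U m (p i \<omega>) (q i))))"
    unfolding sum_distrib_left[of Lam] by (rule sum_mono) (rule cell)
  also have "\<dots> = ln (real (b - m)) * (M * fact m * (\<Sum>i\<in>{n0..<n}. \<Sum>\<omega>\<in>\<Omega>. w \<omega> * esym_deriv U m (p i \<omega>) (q i)))"
    by (subst sum.swap) (simp add: sum_distrib_left mult_ac)
  also have "\<dots> \<le> ln (real (b - m)) * (M * fact m * (\<Sum>i\<in>{n0..<n}. \<kappa>))"
    using m mean by (intro mult_left_mono sum_mono) auto
  finally show ?thesis
    using n0 m M by (simp add: Lam_def \<kappa>_def of_nat_diff mult_ac)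
qed

section \<open>The rate\<close>

text \<open>After division by \<open>n\<close> the two sides of the last inequality tend to
  \<open>K * (1 - \<alpha>)\<close> and \<rho>, and the strict gap between these absorbs all error
  terms.\<close>

lemma eventually_rate_contradiction:
  fixes \<rho> \<theta> e K \<alpha> c :: real
  assumes "0 < e" "e < 1" "0 \<le> \<theta>" "\<theta> < 1" "K * (1 - \<alpha>) < \<rho>" "0 < \<rho>"
  shows "\<forall>\<^sub>F n in sequentially. 0 < 1 - c * e ^ n \<and> 0 < 1 - c\<^sup>2 * \<theta> ^ n \<and> 0 < \<rho> * real n + ln (1 - c * e ^ n) \<and>
    K * (real n - \<alpha> * n + 1) < (1 - c * e ^ n) * (\<rho> * real n + ln (1 - c * e ^ n)) * (1 - c\<^sup>2 * \<theta> ^ n)"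
proof -
  let ?a = "\<lambda>n. 1 - c * e ^ n" and ?t = "\<lambda>n. 1 - c\<^sup>2 * \<theta> ^ n"
  have e0: "(\<lambda>n. e ^ n) \<longlonglongrightarrow> 0" and \<theta>0: "(\<lambda>n. \<theta> ^ n) \<longlonglongrightarrow> 0"
    using assms by (auto intro!: LIMSEQ_realpow_zero)
  have "?a \<longlonglongrightarrow> 1 - c * 0" by (intro tendsto_diff tendsto_mult tendsto_const e0)
  then have a: "?a \<longlonglongrightarrow> 1" by simp
  have "?t \<longlonglongrightarrow> 1 - c\<^sup>2 * 0" by (intro tendsto_diff tendsto_mult tendsto_const \<theta>0)
  then have t: "?t \<longlonglongrightarrow> 1" by simp
  have inv: "(\<lambda>n. 1 / real n) \<longlonglongrightarrow> 0" by (rule lim_1_over_n)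
  have "(\<lambda>n. \<rho> + ln (?a n) * (1 / real n)) \<longlonglongrightarrow> \<rho> + ln 1 * 0"
    by (intro tendsto_add tendsto_mult tendsto_ln tendsto_const a inv) simp
  then have l: "(\<lambda>n. \<rho> + ln (?a n) * (1 / real n)) \<longlonglongrightarrow> \<rho>" by simp
  have "(\<lambda>n. ?a n * (\<rho> + ln (?a n) * (1 / real n)) * ?t n - K * (1 - \<alpha> + 1 / real n)) \<longlonglongrightarrow> 1 * \<rho> * 1 - K * (1 - \<alpha> + 0)"
    by (intro tendsto_intros a t l inv)
  moreover have "1 * \<rho> * 1 - K * (1 - \<alpha> + 0) > 0" using assms(5) by simp
  ultimately have "\<forall>\<^sub>F n in sequentially. ?a n * (\<rho> + ln (?a n) * (1 / real n)) * ?t n - K * (1 - \<alpha> + 1 / real n) > 0"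
    by (rule order_tendstoD)
  moreover have "\<forall>\<^sub>F n in sequentially. ?a n > 0" "\<forall>\<^sub>F n in sequentially. ?t n > 0"
    "\<forall>\<^sub>F n in sequentially. \<rho> + ln (?a n) * (1 / real n) > 0"
    using order_tendstoD(1)[OF a, of 0] order_tendstoD(1)[OF t, of 0] order_tendstoD(1)[OF l assms(6)] by auto
  ultimately show ?thesis
    using eventually_gt_at_top[of 0]
  proof eventually_elim
    case (elim n)
    have eq: "\<rho> * real n + ln (?a n) = n * (\<rho> + ln (?a n) * (1 / real n))"
      using elim(5) by (simp add: field_simps)
    have "K * (real n - \<alpha> * n + 1) = n * (K * (1 - \<alpha> + 1 / real n))"
      using elim(5) by (simp add: field_simps)
    also have "\<dots> < n * (?a n * (\<rho> + ln (?a n) * (1 / real n)) * ?t n)"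
      using elim(1,5) by (intro mult_strict_left_mono) auto
    also have "\<dots> = ?a n * (\<rho> * real n + ln (?a n)) * ?t n"
      unfolding eq by (simp only: mult_ac)
    finally show ?case using elim(2-5) unfolding eq by (intro conjI mult_pos_pos) auto
  qed
qed

lemma A_hash_attained:
  assumes "k > 0"
  obtains C where "hash_code b k n C" "card C = A_hash b k n" "finite C"
proof -
  have finW: "finite (words b n)"
    using finite_lists_length_eq[of "{1..b}" n] by (simp add: words_def conj_commute)
  have "A_hash b k n \<in> {card C | C. hash_code b k n C}"
    unfolding A_hash_def
  proof (rule Max_in)
    have "{card C | C. hash_code b k n C} \<subseteq> card ` Pow (words b n)"
      by (auto simp: hash_code_def)
    then show "finite {card C | C. hash_code b k n C}"
      using finW by (meson finite_Pow_iff finite_imageI finite_subset)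
    \<comment> \<open>For \<open>k = 0\<close> the empty \<open>K\<close> would still demand a
      coordinate, which fails at \<open>n = 0\<close>.\<close>
    have "hash_code b k n {}" using assms by (auto simp: hash_code_def)
    then show "{card C | C. hash_code b k n C} \<noteq> {}" by blast
  qed
  then obtain C where "hash_code b k n C" "card C = A_hash b k n" by auto
  moreover have "finite C"
    using calculation(1) finW unfolding hash_code_def by (blast intro: finite_subset)
  ultimately show thesis by (rule that)
qed

text \<open>Here \<alpha> is the fraction of coordinates spent on choosing the cell. If a code of
  large length \<open>n\<close> had more than \<open>2 ^ (r n)\<close> words, \<open>cell\<close>
  would make the loss from repetitions exponentially small, and \<open>rate\<close> would contradict
  the size bound.\<close>

lemma R_hash_le_of_exponent:
  fixes r \<alpha> :: real
  assumes m: "m \<ge> 2" "m < b" and test: "uniform_test b m" and "0 < r" and \<alpha>: "0 \<le> \<alpha>" "\<alpha> \<le> 1"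
    and cell: "\<alpha> * ln (b / (real m - 1)) < r * ln 2"
    and rate: "ln (real b - m) * (fact m * real ((b - 1) choose m) / real b ^ m) * (1 - \<alpha>) < r * ln 2"
  shows "R_hash b (m + 2) \<le> ereal r"
proof -
  define \<rho> where "\<rho> = r * ln 2"
  define e where "e = exp (- \<rho>)"
  define \<beta> where "\<beta> = b / (real m - 1)"
  define \<theta> where "\<theta> = exp (\<alpha> * ln \<beta> - \<rho>)"
  define K where "K = ln (real b - m) * (fact m * real ((b - 1) choose m) / real b ^ m)"
  have \<rho>: "\<rho> > 0" using assms(4) by (simp add: \<rho>_def)
  have K: "K \<ge> 0" using m by (auto simp: K_def intro!: mult_nonneg_nonneg)
  have \<beta>: "\<beta> \<ge> 1" using m by (simp add: \<beta>_def)
  have "\<forall>\<^sub>F n in sequentially. 0 < 1 - m * e ^ n \<and> 0 < 1 - (real m)\<^sup>2 * \<theta> ^ n \<and> 0 < \<rho> * real n + ln (1 - m * e ^ n) \<and>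
    K * (real n - \<alpha> * n + 1) < (1 - m * e ^ n) * (\<rho> * real n + ln (1 - m * e ^ n)) * (1 - (real m)\<^sup>2 * \<theta> ^ n)"
    using \<rho> cell rate
    by (intro eventually_rate_contradiction) (auto simp: e_def \<theta>_def \<beta>_def K_def \<rho>_def)
  then have "\<forall>\<^sub>F n in sequentially. log 2 (real (A_hash b (m + 2) n)) / real n \<le> r"
    using eventually_gt_at_top[of 0]
  proof eventually_elim
    case (elim n)
    show ?case
    proof (rule ccontr)
      assume "\<not> ?case"
      then have large: "r * n < log 2 (real (A_hash b (m + 2) n))"
        using elim(2) by (simp add: field_simps)
      obtain C where C: "hash_code b (m + 2) n C" "card C = A_hash b (m + 2) n" "finite C"
        by (rule A_hash_attained[of "m + 2" b n]) auto
      define M where "M = real (card C)"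
      have M0: "M > 0"
        using large assms(4) by (cases "card C = 0") (auto simp: M_def C(2) log_def mult_less_0_iff)
      have en: "e ^ n = exp (- (\<rho> * n))"
        by (simp add: e_def exp_of_nat_mult[symmetric] mult.commute)
      have "\<rho> * n < ln M"
        using large M0 by (simp add: \<rho>_def M_def C(2) log_def field_simps)
      then have E: "1 < M * e ^ n"
        using M0 by (simp add: en exp_minus field_simps) (metis exp_ln exp_less_mono)
      define a where "a = 1 - m * e ^ n"
      have a: "a > 0" using elim(1) by (simp add: a_def)
      \<comment> \<open>Since \<open>1 < M * e ^ n\<close>, also
        \<open>m \<le> M * (m * e ^ n)\<close>.\<close>
      have Ma: "M - m \<ge> M * a"
        using mult_left_mono[OF less_imp_le[OF E], of m] by (simp add: a_def algebra_simps)
      then have "M > m" using mult_pos_pos[OF M0 a] by linarith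
      then have "m < card C" by (simp add: M_def)
      then have M1: "M - m \<ge> 1" by (simp add: M_def)
      \<comment> \<open>Rounding down keeps \<open>\<beta> ^ n0\<close> below
        \<open>exp (\<alpha> * n * ln \<beta>)\<close> and costs at most one further coordinate, the
        \<open>+ 1\<close> in the final estimate.\<close>
      define n0 where "n0 = nat \<lfloor>\<alpha> * n\<rfloor>"
      have n0: "real n0 \<le> \<alpha> * n" "\<alpha> * n - 1 < n0"
        using \<alpha> by (auto simp: n0_def)
      have "\<alpha> * n \<le> n" using \<alpha> by (simp add: mult_left_le_one_le)
      then have "n0 \<le> n" using n0 by linarith
      have size: "(M - m) * ln (M - m) * (1 - (real m)\<^sup>2 * \<beta> ^ n0 / M) \<le> K * M * (real n - n0)"
        using hash_code_size_bound[OF C(1,3) m \<open>m < card C\<close> test \<open>n0 \<le> n\<close>]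
        by (simp add: M_def K_def \<beta>_def mult_ac)
      have "ln (M - m) \<ge> \<rho> * n + ln a"
      proof -
        have "ln (M - m) \<ge> ln (M * a)" using Ma M0 a \<open>M > m\<close> by (subst ln_le_cancel_iff) auto
        then show ?thesis using \<open>\<rho> * n < ln M\<close> M0 a by (simp add: ln_mult)
      qed
      moreover have "1 - (real m)\<^sup>2 * \<beta> ^ n0 / M \<ge> 1 - (real m)\<^sup>2 * \<theta> ^ n"
      proof -
        have "\<beta> ^ n0 = exp (n0 * ln \<beta>)" using \<beta> by (simp add: exp_of_nat_mult)
        also have "\<dots> \<le> exp (\<alpha> * n * ln \<beta>)" using n0 \<beta> by (simp add: mult_right_mono)
        finally have "\<beta> ^ n0 * 1 \<le> exp (\<alpha> * n * ln \<beta>) * (M * e ^ n)"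
          using E by (intro mult_mono) auto
        also have "\<dots> = M * \<theta> ^ n"
          by (simp add: en \<theta>_def exp_of_nat_mult[symmetric] exp_add[symmetric] algebra_simps)
        finally have "\<beta> ^ n0 / M \<le> \<theta> ^ n" using M0 by (simp add: field_simps)
        then show ?thesis using mult_left_mono[of "\<beta> ^ n0 / M" "\<theta> ^ n" "(real m)\<^sup>2"] by simp
      qed
      ultimately have "(M * a) * (\<rho> * n + ln a) * (1 - (real m)\<^sup>2 * \<theta> ^ n) \<le> (M - m) * ln (M - m) * (1 - (real m)\<^sup>2 * \<beta> ^ n0 / M)"
        using elim(1) Ma M0 a M1 by (intro mult_mono mult_nonneg_nonneg) (auto simp: a_def)
      also have "\<dots> \<le> K * M * (real n - n0)" by (rule size)
      also have "\<dots> \<le> K * M * (real n - \<alpha> * n + 1)"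
        using n0 K M0 by (intro mult_left_mono) auto
      finally have "M * (a * (\<rho> * n + ln a) * (1 - (real m)\<^sup>2 * \<theta> ^ n)) \<le> M * (K * (real n - \<alpha> * n + 1))"
        by (simp only: mult_ac)
      then have "a * (\<rho> * n + ln a) * (1 - (real m)\<^sup>2 * \<theta> ^ n) \<le> K * (real n - \<alpha> * n + 1)"
        using M0 by (simp only: mult_le_cancel_left_pos)
      then show False using elim(1) by (simp only: a_def) linarith
    qed
  qed
  then show ?thesis
    unfolding R_hash_def by (intro Limsup_bounded) simp
qed

text \<open>
  The fractions \<open>h / g\<close> and \<open>h' / g'\<close> are rational upper approximations of \<open>log 2 (b / (m - 1))\<close>
  and \<open>log 2 (b - m)\<close>.
\<close>
lemma R_hash_le_of_integer_bounds:
  fixes R g h g' h' :: nat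
  assumes m: "m \<ge> 2" "m < b" and test: "uniform_test b m"
    and pos: "0 < R" "0 < g" "0 < h" "0 < g'" and Rg: "R * g \<le> 10 ^ 5 * h"
    and cell: "b ^ g \<le> 2 ^ h * (m - 1) ^ g"
    and colours: "(b - m) ^ g' \<le> 2 ^ h'"
    and rate: "h' * (fact m * ((b - 1) choose m)) * (10 ^ 5 * h - R * g) < R * g' * h * b ^ m"
  shows "R_hash b (m + 2) \<le> ereal (R / 10 ^ 5)"
proof -
  define r where "r = R / 10 ^ 5"
  define \<beta> where "\<beta> = b / (real m - 1)"
  define c where "c = fact m * real ((b - 1) choose m) / real b ^ m"
  define K where "K = ln (real b - m) * c"
  \<comment> \<open>As \<open>h / g\<close> bounds \<open>log 2 \<beta>\<close> from above, this is
    at most the critical fraction \<open>r / log 2 \<beta>\<close>; \<open>Rg\<close> keeps it at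
    most 1.\<close>
  define \<alpha>0 where "\<alpha>0 = r * g / h"
  have r: "r > 0" using pos by (simp add: r_def)
  have \<alpha>0: "0 < \<alpha>0" "\<alpha>0 \<le> 1"
  proof -
    show "0 < \<alpha>0" using r pos by (simp add: \<alpha>0_def)
    have "real (R * g) \<le> real (10 ^ 5 * h)" using Rg by (simp only: of_nat_le_iff)
    then show "\<alpha>0 \<le> 1" using pos by (simp add: \<alpha>0_def r_def field_simps)
  qed
  have \<beta>: "\<beta> > 1" using m by (simp add: \<beta>_def)
  have c: "c > 0" using m by (simp add: c_def)
  have "g * ln \<beta> \<le> h * ln 2"
  proof -
    have "real (b ^ g) \<le> real (2 ^ h * (m - 1) ^ g)" using cell by (simp only: of_nat_le_iff)
    then have "\<beta> ^ g \<le> 2 ^ h"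
      using m by (simp add: \<beta>_def power_divide of_nat_diff field_simps)
    then have "ln (\<beta> ^ g) \<le> ln (2 ^ h)" using \<beta> by (subst ln_le_cancel_iff) auto
    then show ?thesis using \<beta> by (simp add: ln_realpow)
  qed
  then have "r / h * (g * ln \<beta>) \<le> r / h * (h * ln 2)"
    using r by (intro mult_left_mono) auto
  then have cell0: "\<alpha>0 * ln \<beta> \<le> r * ln 2" using pos by (simp add: \<alpha>0_def)
  have rate0: "K * (1 - \<alpha>0) < r * ln 2"
  proof -
    have "real ((b - m) ^ g') \<le> real (2 ^ h')" using colours by (simp only: of_nat_le_iff)
    then have "(real b - m) ^ g' \<le> 2 ^ h'" using m by (simp add: of_nat_diff)
    then have "ln ((real b - m) ^ g') \<le> ln (2 ^ h')" using m by (subst ln_le_cancel_iff) auto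
    then have "g' * ln (real b - m) \<le> h' * ln 2" using m by (simp add: ln_realpow)
    then have "ln (real b - m) \<le> h' / g' * ln 2" using pos by (simp add: field_simps)
    then have "K * (1 - \<alpha>0) \<le> (h' / g' * ln 2) * c * (1 - \<alpha>0)"
      unfolding K_def using \<alpha>0 c by (intro mult_right_mono) auto
    also have "\<dots> < r * ln 2"
    proof -
      have "real (h' * (fact m * ((b - 1) choose m)) * (10 ^ 5 * h - R * g)) < real (R * g' * h * b ^ m)"
        using rate by (simp only: of_nat_less_iff)
      then have "h' * (c * real b ^ m) * (10 ^ 5 * h - real R * g) < R * g' * h * real b ^ m"
        using Rg m by (simp add: of_nat_diff c_def)
      then have "(h' * c * (10 ^ 5 * h - real R * g)) * real b ^ m < (R * g' * h) * real b ^ m"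
        by (simp only: mult_ac)
      then have "h' * c * (10 ^ 5 * h - real R * g) < real R * g' * h"
        using m by (simp add: mult_less_cancel_right_pos)
      then have "h' / g' * c * (1 - \<alpha>0) < r"
        using pos by (simp add: \<alpha>0_def r_def field_simps)
      then have "(h' / g' * c * (1 - \<alpha>0)) * ln 2 < r * ln 2" by (rule mult_strict_right_mono) simp
      then show ?thesis by (simp only: mult_ac)
    qed
    finally show ?thesis .
  qed
  \<comment> \<open>At \<open>\<alpha>0\<close> the cell condition may hold with equality. Moving
    slightly to the left makes it strict, and the strict rate condition survives by
    continuity.\<close>
  have "((\<lambda>x. K * (1 - x)) \<longlongrightarrow> K * (1 - \<alpha>0)) (at_left \<alpha>0)"
    by (intro tendsto_intros)
  then have "\<forall>\<^sub>F x in at_left \<alpha>0. K * (1 - x) < r * ln 2"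
    using rate0 by (rule order_tendstoD)
  moreover have "\<forall>\<^sub>F x in at_left \<alpha>0. x \<in> {0<..<\<alpha>0}"
    by (rule eventually_at_leftI[OF _ \<alpha>0(1)])
  ultimately have "\<forall>\<^sub>F x in at_left \<alpha>0. K * (1 - x) < r * ln 2 \<and> x \<in> {0<..<\<alpha>0}"
    by eventually_elim auto
  then obtain \<alpha> where \<alpha>: "K * (1 - \<alpha>) < r * ln 2" "0 < \<alpha>" "\<alpha> < \<alpha>0"
    using eventually_happens'[OF trivial_limit_at_left_real] by auto
  have "\<alpha> * ln \<beta> < \<alpha>0 * ln \<beta>" using \<alpha> \<beta> by simp
  then show ?thesis
    using R_hash_le_of_exponent[OF m test r, of \<alpha>] \<alpha> \<alpha>0 cell0
    by (simp add: r_def \<beta>_def K_def c_def)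
qed

section \<open>Numerical evaluation\<close>

text \<open>The absorption identity as a rewrite rule: each step leaves a single smaller binomial,
  whereas Pascal's rule would branch.\<close>

lemma choose_numeral:
  "(numeral n choose numeral k) = numeral n * (pred_numeral n choose pred_numeral k) div numeral k"
  using times_binomial_minus1_eq[of "numeral k" "numeral n"]
  by (metis diff_Suc_1 nonzero_mult_div_cancel_left numeral_eq_Suc zero_less_Suc zero_neq_numeral)

lemmas test_eval = uniform_test_def atLeastLessThan_nat_numeral choose_numeral binomial_eq_0 fact_numeral

theorem mainTheorem4:
  shows "R_hash 5 5 \<le> 0.16894 \<and> R_hash 6 5 \<le> 0.34512 \<and>
    R_hash 6 6 \<le> 0.08475 \<and> R_hash 7 6 \<le> 0.19897 \<and> R_hash 8 6 \<le> 0.31799 \<and>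
    R_hash 9 6 \<le> 0.43237 \<and> R_hash 10 6 \<le> 0.53909 \<and> R_hash 11 6 \<le> 0.63766 \<and>
    R_hash 12 6 \<le> 0.72848 \<and> R_hash 13 6 \<le> 0.81227 \<and> R_hash 14 6 \<le> 0.88978 \<and>
    R_hash 7 7 \<le> 0.04090 \<and> R_hash 8 7 \<le> 0.10865 \<and> R_hash 9 7 \<le> 0.19054 \<and>
    R_hash 10 7 \<le> 0.27741 \<and> R_hash 11 7 \<le> 0.36424 \<and> R_hash 12 7 \<le> 0.44850 \<and>
    R_hash 13 7 \<le> 0.52902 \<and> R_hash 14 7 \<le> 0.60538 \<and>
    R_hash 8 8 \<le> 0.01889 \<and> R_hash 9 8 \<le> 0.05616 \<and> R_hash 10 8 \<le> 0.10791 \<and>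
    R_hash 11 8 \<le> 0.16878 \<and> R_hash 12 8 \<le> 0.23451 \<and> R_hash 13 8 \<le> 0.30214 \<and>
    R_hash 14 8 \<le> 0.36974 \<and>
    R_hash 10 9 \<le> 0.02773 \<and> R_hash 11 9 \<le> 0.05796 \<and> R_hash 12 9 \<le> 0.09730 \<and>
    R_hash 13 9 \<le> 0.14332 \<and> R_hash 14 9 \<le> 0.19382 \<and>
    R_hash 11 10 \<le> 0.01321 \<and> R_hash 12 10 \<le> 0.02978 \<and> R_hash 13 10 \<le> 0.05342 \<and>
    R_hash 14 10 \<le> 0.08332 \<and>
    R_hash 13 11 \<le> 0.01476 \<and> R_hash 14 11 \<le> 0.02815 \<and>
    R_hash 14 12 \<le> 0.00712 \<and> R_hash 15 13 \<le> 0.00335"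
proof (intro conjI)
  \<comment> \<open>The arguments are, in order, \<open>m = k - 2\<close>, \<open>b\<close>, the
    bound times \<open>10 ^ 5\<close>, then \<open>g h\<close> with \<open>h / g\<close> at least
    \<open>log 2 (b / (m - 1))\<close>, and \<open>g' h'\<close> with \<open>h' / g'\<close> at
    least \<open>log 2 (b - m)\<close>.\<close>
  show "R_hash 5 5 \<le> 0.16894"
    using R_hash_le_of_integer_bounds[of 3 5 16894 3 4 1 1] by (simp add: test_eval)
  show "R_hash 6 5 \<le> 0.34512"
    using R_hash_le_of_integer_bounds[of 3 6 34512 17 27 29 46] by (simp add: test_eval)
  show "R_hash 6 6 \<le> 0.08475"
    using R_hash_le_of_integer_bounds[of 4 6 8475 1 1 1 1] by (simp add: test_eval)
  show "R_hash 7 6 \<le> 0.19897"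
    using R_hash_le_of_integer_bounds[of 4 7 19897 319 390 306 485] by (simp add: test_eval)
  show "R_hash 8 6 \<le> 0.31799"
    using R_hash_le_of_integer_bounds[of 4 8 31799 53 75 1 2] by (simp add: test_eval)
  show "R_hash 9 6 \<le> 0.43237"
    using R_hash_le_of_integer_bounds[of 4 9 43237 200 317 205 476] by (simp add: test_eval)
  show "R_hash 10 6 \<le> 0.53909"
    using R_hash_le_of_integer_bounds[of 4 10 53909 346 601 306 791] by (simp add: test_eval)
  show "R_hash 11 6 \<le> 0.63766"
    using R_hash_le_of_integer_bounds[of 4 11 63766 239 448 244 685] by (simp add: test_eval)
  show "R_hash 12 6 \<le> 0.72848"
    using R_hash_le_of_integer_bounds[of 4 12 72848 1 2 1 3] by (simp add: test_eval)
  show "R_hash 13 6 \<le> 0.81227"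
    using R_hash_le_of_integer_bounds[of 4 13 81227 381 806 153 485] by (simp add: test_eval)
  show "R_hash 14 6 \<le> 0.88978"
    using R_hash_le_of_integer_bounds[of 4 14 88978 580 1289 351 1166] by (simp add: test_eval)
  show "R_hash 7 7 \<le> 0.04090"
    using R_hash_le_of_integer_bounds[of 5 7 4090 6 5 1 1] by (simp add: test_eval)
  show "R_hash 8 7 \<le> 0.10865"
    using R_hash_le_of_integer_bounds[of 5 8 10865 1 1 200 317] by (simp add: test_eval)
  show "R_hash 9 7 \<le> 0.19054"
    using R_hash_le_of_integer_bounds[of 5 9 19054 153 179 1 2] by (simp add: test_eval)
  show "R_hash 10 7 \<le> 0.27741"
    using R_hash_le_of_integer_bounds[of 5 10 27741 59 78 351 815] by (simp add: test_eval)
  show "R_hash 11 7 \<le> 0.36424"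
    using R_hash_le_of_integer_bounds[of 5 11 36424 37 54 253 654] by (simp add: test_eval)
  show "R_hash 12 7 \<le> 0.44850"
    using R_hash_le_of_integer_bounds[of 5 12 44850 147 233 244 685] by (simp add: test_eval)
  show "R_hash 13 7 \<le> 0.52902"
    using R_hash_le_of_integer_bounds[of 5 13 52902 197 335 1 3] by (simp add: test_eval)
  show "R_hash 14 7 \<le> 0.60538"
    using R_hash_le_of_integer_bounds[of 5 14 60538 244 441 153 485] by (simp add: test_eval)
  show "R_hash 8 8 \<le> 0.01889"
    using R_hash_le_of_integer_bounds[of 6 8 1889 1 1 1 1] by (simp add: test_eval)
  show "R_hash 9 8 \<le> 0.05616"
    using R_hash_le_of_integer_bounds[of 6 9 5616 33 28 41 65] by (simp add: test_eval)
  show "R_hash 10 8 \<le> 0.10791"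
    using R_hash_le_of_integer_bounds[of 6 10 10791 1 1 1 2] by (simp add: test_eval)
  show "R_hash 11 8 \<le> 0.16878"
    using R_hash_le_of_integer_bounds[of 6 11 16878 109 124 59 137] by (simp add: test_eval)
  show "R_hash 12 8 \<le> 0.23451"
    using R_hash_le_of_integer_bounds[of 6 12 23451 19 24 200 517] by (simp add: test_eval)
  show "R_hash 13 8 \<le> 0.30214"
    using R_hash_le_of_integer_bounds[of 6 13 30214 140 193 135 379] by (simp add: test_eval)
  show "R_hash 14 8 \<le> 0.36974"
    using R_hash_le_of_integer_bounds[of 6 14 36974 103 153 1 3] by (simp add: test_eval)
  show "R_hash 10 9 \<le> 0.02773"
    using R_hash_le_of_integer_bounds[of 7 10 2773 4 3 29 46] by (simp add: test_eval)
  show "R_hash 11 9 \<le> 0.05796"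
    using R_hash_le_of_integer_bounds[of 7 11 5796 8 7 1 2] by (simp add: test_eval)
  show "R_hash 12 9 \<le> 0.09730"
    using R_hash_le_of_integer_bounds[of 7 12 9730 1 1 59 137] by (simp add: test_eval)
  show "R_hash 13 9 \<le> 0.14332"
    using R_hash_le_of_integer_bounds[of 7 13 14332 95 106 200 517] by (simp add: test_eval)
  show "R_hash 14 9 \<le> 0.19382"
    using R_hash_le_of_integer_bounds[of 7 14 19382 229 280 244 685] by (simp add: test_eval)
  show "R_hash 11 10 \<le> 0.01321"
    using R_hash_le_of_integer_bounds[of 8 11 1321 3 2 17 27] by (simp add: test_eval)
  show "R_hash 12 10 \<le> 0.02978"
    using R_hash_le_of_integer_bounds[of 8 12 2978 9 7 1 2] by (simp add: test_eval)
  show "R_hash 13 10 \<le> 0.05342"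
    using R_hash_le_of_integer_bounds[of 8 13 5342 47 42 59 137] by (simp add: test_eval)
  show "R_hash 14 10 \<le> 0.08332"
    using R_hash_le_of_integer_bounds[of 8 14 8332 1 1 306 791] by (simp add: test_eval)
  show "R_hash 13 11 \<le> 0.01476"
    using R_hash_le_of_integer_bounds[of 9 13 1476 7 5 1 2] by (simp add: test_eval)
  show "R_hash 14 11 \<le> 0.02815"
    using R_hash_le_of_integer_bounds[of 9 14 2815 16 13 59 137] by (simp add: test_eval)
  show "R_hash 14 12 \<le> 0.00712"
    using R_hash_le_of_integer_bounds[of 10 14 712 3 2 1 2] by (simp add: test_eval)
  show "R_hash 15 13 \<le> 0.00335"
    using R_hash_le_of_integer_bounds[of 11 15 335 1 1 1 2] by (simp add: test_eval)
qed

end
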